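(* Let $n$ and $b$ be nonnegative integers with $0.2495\,n \leq b < n/4$. Then every graph on $n$ vertices with at least $n^2/4$ edges and book number at most $b$ which is not the balanced complete bipartite graph has at least $b^2(n-4b)$ triangles, with equality if and only if the graph is (isomorphic to) $S_{b,n}$.
   Context: A book in a graph is a collection of triangles sharing a common edge; its size is the number of such triangles. The book number $b(G)$ of a graph $G$ is the size of the largest book in $G$, i.e. the maximum over edges $uv$ of the number of common neighbours of $u$ and $v$. The balanced complete bipartite graph on $n$ vertices is the complete bipartite graph with parts of sizes $\lfloor n/2\rfloor$ and $\lceil n/2\rceil$. For nonnegative integers $b \le n/4$, $S_{b,n}$ is the graph on $n$ vertices whose vertex set is partitioned into six parts $U_1,U_2,U_3,V_1,V_2,V_3$ with $|U_1|=|U_2|=|V_1|=|V_2|=b$, $|U_3|=\lfloor (n-4b)/2\rfloor$, $|V_3|=\lceil (n-4b)/2\rceil$, where $U_i$ is complete to $U_j$ for $i\neq j$, $V_i$ is complete to $V_j$ for $i \neq j$, $U_i$ is complete to $V_i$ for each $i$, and there are no other edges (a blow-up of the $3$-prism, i.e. two disjoint triangles joined by a perfect matching). It has $\lfloor n^2/4\rfloor$ edges and $b^2(n-4b)$ triangles. *)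

theory Defs
  imports Complex_Main "HOL-Library.Ramsey"
begin

record 'a ugraph =
  verts :: "'a set"
  edges :: "'a set set"

definition simple_graph :: "'a ugraph \<Rightarrow> bool" where
  "simple_graph G \<longleftrightarrow> finite (verts G) \<and> edges G \<subseteq> nsets (verts G) 2"

definition graph_iso :: "'a ugraph \<Rightarrow> 'b ugraph \<Rightarrow> bool" where
  "graph_iso G H \<longleftrightarrow>
     (\<exists>f. bij_betw f (verts G) (verts H) \<and>
          (\<forall>u\<in>verts G. \<forall>v\<in>verts G. {u, v} \<in> edges G \<longleftrightarrow> {f u, f v} \<in> edges H))"

definition triangles :: "'a ugraph \<Rightarrow> 'a set set" where
  "triangles G = {T \<in> nsets (verts G) 3. nsets T 2 \<subseteq> edges G}"

definition is_book :: "'a ugraph \<Rightarrow> 'a set set \<Rightarrow> bool" where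
  "is_book G B \<longleftrightarrow> B \<subseteq> triangles G \<and> (\<exists>e\<in>edges G. \<forall>T\<in>B. e \<subseteq> T)"

(* The 0 only matters for edgeless graphs, which contain no book at all;
   if there is an edge, the empty book already has size 0. *)
definition book_number :: "'a ugraph \<Rightarrow> nat" where
  "book_number G = Max (insert 0 (card ` {B. is_book G B}))"

definition complete_bipartite :: "nat \<Rightarrow> nat \<Rightarrow> (nat + nat) ugraph" where
  "complete_bipartite p q =
     \<lparr>verts = {..<p} <+> {..<q}, edges = {{Inl i, Inr j} | i j. i < p \<and> j < q}\<rparr>"

definition balanced_complete_bipartite :: "nat \<Rightarrow> (nat + nat) ugraph" where
  "balanced_complete_bipartite n =
     complete_bipartite (nat \<lfloor>real n / 2\<rfloor>) (nat \<lceil>real n / 2\<rceil>)"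

datatype prism_vertex = U1 | U2 | U3 | V1 | V2 | V3

definition prism_edges :: "prism_vertex set set" where
  "prism_edges =
     {{U1, U2}, {U1, U3}, {U2, U3},
      {V1, V2}, {V1, V3}, {V2, V3},
      {U1, V1}, {U2, V2}, {U3, V3}}"

(* Meaningful for 4 * b \<le> n; otherwise nat truncates the last parts to 0. *)
fun S_part_size :: "nat \<Rightarrow> nat \<Rightarrow> prism_vertex \<Rightarrow> nat" where
  "S_part_size b n U3 = nat \<lfloor>(real n - 4 * real b) / 2\<rfloor>"
| "S_part_size b n V3 = nat \<lceil>(real n - 4 * real b) / 2\<rceil>"
| "S_part_size b n _ = b"

(* The vertices (p, 0), (p, 1), ... form the part that replaces the prism vertex p. *)
definition S_graph :: "nat \<Rightarrow> nat \<Rightarrow> (prism_vertex \<times> nat) ugraph" where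
  "S_graph b n =
     \<lparr>verts = (SIGMA p:UNIV. {..<S_part_size b n p}),
      edges = {{(p, i), (q, j)} | p i q j.
                 i < S_part_size b n p \<and> j < S_part_size b n q \<and> {p, q} \<in> prism_edges}\<rparr>"

end

theory Submission
  imports Defs
begin

text \<open>
  Put \<open>k = n - 4b\<close> and suppose that \<open>G\<close> has at most \<open>b\<^sup>2k\<close> triangles. Averaging the cuts
  \<open>(N(u), V - N(u))\<close> over \<open>u\<close> gives a maximum cut \<open>(A, B)\<close> with \<open>O(bk)\<close> edges inside its sides, hence
  with \<open>O(bk)\<close> missing edges across. An edge inside a side has at most \<open>b\<close> common neighbours, so one of its
  ends misses about \<open>b\<close> vertices of the other side; let \<open>H\<close> be the set of all such vertices. It has
  \<open>h = O(k)\<close> elements and the sets \<open>P = A - H\<close>, \<open>Q = B - H\<close> are independent.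

  Let \<open>\<sigma>(x)\<close> be the number of neighbours of \<open>x \<in> H\<close> outside \<open>H\<close>. Counting edges gives
  \<open>\<Sum> (2b - \<sigma>(x)) + missing(P, Q) \<le> e(H) - h\<^sup>2/4 + h(h - k)/2\<close>, while the book condition forces
  \<open>\<sigma>(x) \<le> 2b\<close> up to missing edges, with a further loss for every triangle having two vertices in \<open>H\<close>.
  Mantel's theorem applied to the edges of \<open>H\<close> separated by a neighbourhood \<open>N(v) \<inter> H\<close>, summed over
  \<open>v \<in> P \<union> Q\<close>, shows that an excess of \<open>e(H)\<close> over \<open>h\<^sup>2/4\<close> creates many such triangles and costs more
  than it gains. Hence \<open>h \<ge> k\<close>. Since nearly every \<open>x \<in> H\<close> lies in about \<open>b\<^sup>2\<close> triangles with the two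
  other vertices in \<open>P\<close> and \<open>Q\<close>, it follows that \<open>h = k\<close> and that all estimates are equalities, which
  leaves only \<open>S\<^bsub>b,n\<^esub>\<close>, where \<open>H = U\<^sub>3 \<union> V\<^sub>3\<close>. If \<open>H\<close> is empty, \<open>G\<close> is balanced complete bipartite.
\<close>

subsection \<open>Estimates for the exceptional vertices\<close>

text \<open>
  \<open>p\<close> and \<open>q\<close> are the degrees of a vertex of \<open>H\<close> into \<open>P\<close> and \<open>Q\<close>, and \<open>t\<close> is the number of edges between the
  two neighbourhoods, \<open>M\<close> being the number of missing ones. The term \<open>12M/b\<close> makes the deficit \<open>E\<close>
  nonnegative even if \<open>p\<close> or \<open>q\<close> slightly exceeds \<open>b\<close>.
\<close>

lemma bad_vertex_estimates:
  fixes b p q M t CA CB :: real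
  assumes b: "b > 0" and M: "0 \<le> M" "M \<le> (121 / 10000) * b^2" and t: "t = p * q - M" "0 \<le> t"
    and C: "0 \<le> CA" "0 \<le> CB" "t + CA \<le> b * p" "t + CB \<le> b * q" "CA + CB \<le> (11 / 200) * b^2"
    and type: "(b / 6 \<le> p \<and> b / 6 \<le> q) \<or> p + q \<le> (173 / 100) * b"
    and E: "E = 2 * b - p - q + 12 * M / b"
  shows "0 \<le> E" "CA + CB \<le> (23 / 20) * b * E + 3 * M" "b^2 - 4 * b * E - 2 * M \<le> t"
    "E = 0 \<Longrightarrow> M = 0 \<Longrightarrow> p = b \<and> q = b"
proof -
  \<comment> \<open>\<open>m\<close> bounds the excess of \<open>p\<close> or \<open>q\<close> over
    \<open>b\<close>: \<open>t \<le> b * p\<close> gives \<open>(q - b) * p \<le> M\<close>, and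
    \<open>p\<close> is at least \<open>b / 6\<close> in the second case. The correction in
    \<open>E\<close> is \<open>2 * m\<close>.\<close>
  define m where "m = 6 * M / b"
  have bm: "b * m = 6 * M" using b by (simp add: m_def)
  have m0: "0 \<le> m" using b M by (simp add: m_def)
  have Em: "E = 2 * b - p - q + 2 * m" using E by (simp add: m_def)
  have "b * m \<le> b * ((73 / 1000) * b)" using M unfolding bm by (simp add: power2_eq_square)
  hence mb: "m \<le> (73 / 1000) * b" using b by simp
  have mm: "m * m \<le> (11 / 25) * M"
    using mult_right_mono[OF mb m0] bm M by simp
  have "0 \<le> E \<and> CA + CB \<le> (23 / 20) * b * E + 3 * M \<and> b^2 - 4 * b * E - 2 * M \<le> t \<and>
    (E = 0 \<longrightarrow> M = 0 \<longrightarrow> p = b \<and> q = b)"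
  \<comment> \<open>If \<open>p + q\<close> is at most \<open>1.73 * b\<close>, then
    \<open>E\<close> is at least \<open>0.27 * b\<close>, and crude bounds suffice:
    \<open>(23 / 20) * 0.27\<close> exceeds \<open>11 / 200\<close>, and \<open>4 * 0.27\<close>
    exceeds 1.\<close>
  proof (cases "p + q \<le> (173 / 100) * b")
    case True
    have E1: "(27 / 100) * b \<le> E" using True m0 Em by simp
    have "b * ((27 / 100) * b) \<le> b * E" using E1 b by (intro mult_left_mono) auto
    hence bE: "(27 / 100) * b^2 \<le> b * E" by (simp add: power2_eq_square)
    have b2: "b^2 > 0" using b by simp
    have "CA + CB \<le> (23 / 20) * b * E + 3 * M" using bE C b2 M by linarith
    moreover have "b^2 - 4 * b * E - 2 * M \<le> t" using bE t b2 M by linarith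
    moreover have "0 < E" using E1 b by linarith
    ultimately show ?thesis by simp
  next
    case False
    hence p6: "b / 6 \<le> p" and q6: "b / 6 \<le> q" using type by auto
    have "(q - b) * p \<le> M" "(p - b) * q \<le> M" using t C by (auto simp: algebra_simps)
    have aux: "u - b \<le> m" if "(u - b) * v \<le> M" "b / 6 \<le> v" for u v
    proof (cases "u \<le> b")
      case False
      hence "(u - b) * (b / 6) \<le> (u - b) * v" using that by (intro mult_left_mono) auto
      hence "(u - b) * (b / 6) \<le> M" using that by linarith
      hence "b * (u - b) \<le> b * m" using bm by (simp add: algebra_simps)
      thus ?thesis using b by simp
    qed (use m0 in simp)
    have qm: "q - b \<le> m" and pm: "p - b \<le> m"
      using aux[OF \<open>(q - b) * p \<le> M\<close> p6] aux[OF \<open>(p - b) * q \<le> M\<close> q6] .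
    have E0: "0 \<le> E" using qm pm Em by simp
    \<comment> \<open>This controls the product \<open>(b - p) * (b - q)\<close>, which is negative
      when exactly one of \<open>p\<close>, \<open>q\<close> exceeds \<open>b\<close>.\<close>
    have "0 \<le> (b - p + m) * (b - q + m)" using qm pm by (intro mult_nonneg_nonneg) auto
    moreover have "(b - p + m) * (b - q + m) = (b - p) * (b - q) + m * E - m * m"
      unfolding Em by (simp add: algebra_simps)
    ultimately have ab: "- (m * E) \<le> (b - p) * (b - q)" using mult_nonneg_nonneg[OF m0 m0] by linarith
    have mE: "m * E \<le> (73 / 1000) * (b * E)" using mult_right_mono[OF mb E0] by simp
    have bE: "0 \<le> b * E" using b E0 by simp
    have tt: "t = b^2 - b * E + 2 * (b * m) + (b - p) * (b - q) - M"
      unfolding Em t by (simp add: algebra_simps power2_eq_square)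
    have "CA + CB \<le> b * p + b * q - 2 * t" using C by simp
    also have "\<dots> = b * E - 2 * (b * m) - 2 * ((b - p) * (b - q)) + 2 * M"
      unfolding Em t by (simp add: algebra_simps power2_eq_square)
    finally have "CA + CB \<le> b * E + 2 * M - 12 * M + 2 * (m * E)"
      using ab bm by linarith
    hence "CA + CB \<le> (23 / 20) * b * E + 3 * M" using mE M bE by linarith
    moreover have "b^2 - 4 * b * E - 2 * M \<le> t"
      using tt ab bm mE bE M by linarith
    moreover have "E = 0 \<longrightarrow> M = 0 \<longrightarrow> p = b \<and> q = b" using qm pm Em bm b by auto
    ultimately show ?thesis using E0 by simp
  qed
  thus "0 \<le> E" "CA + CB \<le> (23 / 20) * b * E + 3 * M" "b^2 - 4 * b * E - 2 * M \<le> t"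
    "E = 0 \<Longrightarrow> M = 0 \<Longrightarrow> p = b \<and> q = b" by auto
qed

text \<open>
  \<open>S\<close> is \<open>\<Sum> \<sigma>(x)\<close> over \<open>H\<close>, \<open>F\<close> is twice the number of edges in \<open>H\<close>, \<open>m0\<close> counts the missing edges between
  \<open>P\<close> and \<open>Q\<close>, and \<open>X\<close> is \<open>\<Sum> d\<^sub>H(x) \<sigma>(x)\<close>; \<open>Es\<close>, \<open>MS\<close>, \<open>CS\<close>, \<open>ts\<close> are the sums of the quantities of the
  previous lemma. Assumption \<open>Y\<close> is the averaged form of Mantel's theorem.
\<close>

lemma bad_set_estimates:
  fixes h k b n a0 b0 m0 S F Es MS CS X ts :: real
  assumes b: "b > 0" and h: "0 < h" "h \<le> (11 / 200) * b" and k: "0 < k" "n = 4 * b + k"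
    and ab: "a0 + b0 = n - h" and m0: "0 \<le> m0" and F: "0 \<le> F" "F \<le> h^2"
    and edges: "n^2 / 2 \<le> 2 * (a0 * b0 - m0) + 2 * S + F"
    and MS: "0 \<le> MS" "MS \<le> h * m0"
    and Es: "Es = 2 * b * h - S + 12 * MS / b" "0 \<le> Es"
    and Y: "(n - h) * (F - h^2 / 2) \<le> (n - h) * F - 2 * X + 2 * CS"
    and X: "2 * b * F - h * Es \<le> X"
    and CS: "CS \<le> (23 / 20) * b * Es + 3 * MS"
    and ts: "h * b^2 - 4 * b * Es - 2 * MS \<le> ts" "ts \<le> b^2 * k"
  shows "h = k \<and> Es = 0 \<and> m0 = 0 \<and> a0 = b0 \<and> F = h^2 / 2"
proof -
  \<comment> \<open>\<open>d\<close> measures the imbalance of \<open>P\<close> and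
    \<open>Q\<close>, \<open>y\<close> is the excess of the number of edges in \<open>H\<close> over
    Mantel's bound, and \<open>N\<close> is the number of vertices outside \<open>H\<close>.\<close>
  define d where "d = (a0 - b0)^2 / 4"
  define y where "y = F / 2 - h^2 / 4"
  define N where "N = n - h"
  have N: "(789 / 200) * b \<le> N" using h k by (simp add: N_def)
  have d: "0 \<le> d" by (simp add: d_def)
  have abd: "a0 * b0 = N^2 / 4 - d"
  proof -
    have "N = a0 + b0" using ab N_def by simp
    thus ?thesis by (simp add: d_def field_simps power2_eq_square)
  qed
  have MSb: "12 * MS / b \<le> (33 / 50) * m0"
  proof -
    have "h * m0 \<le> (11 / 200) * b * m0" using h m0 by (intro mult_right_mono) auto
    hence "MS \<le> (11 / 200) * b * m0" using MS by simp
    hence "12 * MS \<le> (33 / 50) * m0 * b" by simp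
    thus ?thesis using b by (simp add: pos_divide_le_eq)
  qed
  have e1: "2 * b * h - S + m0 + d \<le> y + h * (h - k) / 2"
    using edges unfolding abd y_def N_def k by (simp add: field_simps power2_eq_square)
  \<comment> \<open>Replacing \<open>2 * b * h - S\<close> by \<open>Es\<close> costs
    \<open>12 * MS / b\<close>, at most \<open>33 / 50\<close> of \<open>m0\<close>; the remaining
    \<open>17 / 50\<close> is kept.\<close>
  hence e2: "Es + (17 / 50) * m0 + d \<le> y + h * (h - k) / 2"
  proof -
    obtain z where z: "z = 12 * MS / b" by simp
    show ?thesis using e1 Es(1) MSb unfolding z[symmetric] by linarith
  qed
  have "N * y \<le> ((23 / 20) * b + h) * Es + 3 * MS + (k - h) * F / 2"
  proof -
    have "2 * (N * y) \<le> N * F - 2 * X + 2 * CS" using Y unfolding N_def y_def by (simp add: field_simps)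
    also have "\<dots> \<le> N * F - 2 * (2 * b * F - h * Es) + 2 * ((23 / 20) * b * Es + 3 * MS)"
      using X CS by (intro add_mono diff_mono order_refl mult_left_mono[of _ _ 2]) auto
    also have "\<dots> = 2 * (((23 / 20) * b + h) * Es + 3 * MS + (k - h) * F / 2)"
      unfolding N_def k by (simp add: field_simps)
    finally show ?thesis by simp
  qed
  also have "\<dots> \<le> (241 / 200) * b * Es + (33 / 200) * b * m0 + (k - h) * F / 2"
  proof -
    have "((23 / 20) * b + h) * Es \<le> (241 / 200) * b * Es" using h Es by (intro mult_right_mono) auto
    moreover have "h * m0 \<le> (11 / 200) * b * m0" using h m0 by (intro mult_right_mono) auto
    ultimately show ?thesis using MS by linarith
  qed
  finally have y1: "N * y \<le> (241 / 200) * b * Es + (33 / 200) * b * m0 + (k - h) * F / 2" .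
  have bEs: "0 \<le> b * Es" and bm: "0 \<le> b * m0" using b Es m0 by auto
  \<comment> \<open>\<open>e2\<close> bounds \<open>y\<close> from below and \<open>y1\<close>
    bounds it from above. Comparing them eliminates \<open>y\<close> and leaves positive multiples
    of \<open>Es\<close>, \<open>m0\<close> and \<open>d\<close> against a multiple of
    \<open>h - k\<close>.\<close>
  have "N * (Es + (17 / 50) * m0 + d) \<le> N * (y + h * (h - k) / 2)"
    using e2 N b by (intro mult_left_mono) auto
  hence "N * Es + (17 / 50) * (N * m0) + N * d \<le> N * y + N * (h * (h - k) / 2)"
    by (simp add: distrib_left)
  moreover have "(k - h) * F / 2 + N * (h * (h - k) / 2) = (h - k) * (N * h / 2 - F / 2)"
    by (simp add: field_simps)
  moreover have "(789 / 200) * (b * Es) \<le> N * Es"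
    using mult_right_mono[OF N Es(2)] by (simp only: mult.assoc)
  moreover have "(789 / 200) * (b * m0) \<le> N * m0"
    using mult_right_mono[OF N m0] by (simp only: mult.assoc)
  moreover have "0 \<le> N * d" using N d b by simp
  ultimately have main: "(137 / 50) * (b * Es) + (147 / 125) * (b * m0) + N * d
      \<le> (h - k) * (N * h / 2 - F / 2)"
    using bm y1 unfolding mult.assoc by linarith
  have pos: "0 < N * h / 2 - F / 2"
  proof -
    have "h * h < N * h" using h N b by (intro mult_strict_right_mono) auto
    thus ?thesis using F by (simp add: power2_eq_square)
  qed
  have hk: "k \<le> h"
  proof (rule ccontr)
    assume "\<not> k \<le> h"
    hence "(h - k) * (N * h / 2 - F / 2) < 0" using pos by (intro mult_neg_pos) auto
    thus False using main bEs bm \<open>0 \<le> N * d\<close> by linarith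
  qed
  have Nb: "N * h / 2 - F / 2 \<le> (227 / 2000) * b * b"
  proof -
    have "k \<le> (11 / 200) * b" using hk h by simp
    hence "N \<le> (811 / 200) * b" using h k N_def by simp
    hence "N * h \<le> ((811 / 200) * b) * ((11 / 200) * b)" using h b by (intro mult_mono) auto
    hence "N * h \<le> (227 / 1000) * (b * b)" using mult_pos_pos[OF b b] by simp
    thus ?thesis using F by simp
  qed
  have "(h - k) * (N * h / 2 - F / 2) \<le> (h - k) * ((227 / 2000) * b * b)"
    using hk Nb by (intro mult_left_mono) auto
  hence "(137 / 50) * (b * Es) + (147 / 125) * (b * m0) + N * d \<le> (227 / 2000) * (b^2 * (h - k))"
    by (intro order_trans[OF main]) (simp add: power2_eq_square mult_ac)
  moreover have "h * m0 \<le> (11 / 200) * b * m0" using h m0 by (intro mult_right_mono) auto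
  hence "h * b^2 - 4 * (b * Es) - (11 / 100) * (b * m0) \<le> b^2 * k" using ts MS by linarith
  hence "b^2 * (h - k) \<le> 4 * (b * Es) + (11 / 100) * (b * m0)" by (simp add: algebra_simps)
  moreover have "0 \<le> b^2 * (h - k)" using hk by simp
  \<comment> \<open>The triangle count bounds \<open>b^2 * (h - k)\<close> by
    \<open>4 * (b * Es) + (11 / 100) * (b * m0)\<close>. Multiplied by \<open>227 / 2000\<close>,
    these coefficients fall below \<open>137 / 50\<close> and \<open>147 / 125\<close>, so
    everything must vanish.\<close>
  ultimately have z: "b^2 * (h - k) = 0" "b * Es = 0" "b * m0 = 0" "N * d = 0"
    using bEs bm \<open>0 \<le> N * d\<close> by linarith+
  hence *: "h = k" "Es = 0" "m0 = 0" "d = 0" using b N by auto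
  have "0 \<le> y" using e2 * by simp
  moreover have "N * y \<le> 0" using y1 * by simp
  ultimately have "y = 0" using N b by (simp add: mult_le_0_iff)
  moreover have "a0 = b0" using \<open>d = 0\<close> by (simp add: d_def)
  ultimately show ?thesis using * by (simp add: y_def)
qed

subsection \<open>Maximum cuts\<close>

text \<open>A graph given by its 0/1 adjacency matrix over the reals, so that counts of edges and
  triangles become sums that can be exchanged and compared linearly.\<close>

locale weighted_graph =
  fixes V :: "'a set" and w :: "'a \<Rightarrow> 'a \<Rightarrow> real"
  assumes fin: "finite V"
    and w01: "w u v = 0 \<or> w u v = 1"
    and w_sym: "w u v = w v u"
    and w_irrefl: "w u u = 0"
begin

definition dg :: "'a set \<Rightarrow> 'a \<Rightarrow> real" where
  "dg X u = (\<Sum>v\<in>X. w u v)"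

definition cod :: "'a set \<Rightarrow> 'a \<Rightarrow> 'a \<Rightarrow> real" where
  "cod X u v = (\<Sum>z\<in>X. w u z * w v z)"

lemma w_nonneg: "0 \<le> w u v" and w_le_1: "w u v \<le> 1"
  using w01[of u v] by auto

lemma dg_nonneg: "0 \<le> dg X u"
  unfolding dg_def by (intro sum_nonneg w_nonneg)

lemma dg_le_card: "dg X u \<le> card X"
  unfolding dg_def using sum_bounded_above[of X "w u" 1] w_le_1 by simp

lemma dg_Un: "finite X \<Longrightarrow> finite Y \<Longrightarrow> X \<inter> Y = {} \<Longrightarrow> dg (X \<union> Y) u = dg X u + dg Y u"
  unfolding dg_def by (rule sum.union_disjoint)

lemma dg_Diff: "finite Y \<Longrightarrow> X \<subseteq> Y \<Longrightarrow> dg (Y - X) u = dg Y u - dg X u"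
  unfolding dg_def by (rule sum_diff)

lemma dg_mono: "finite Y \<Longrightarrow> X \<subseteq> Y \<Longrightarrow> dg X u \<le> dg Y u"
  unfolding dg_def by (intro sum_mono2 w_nonneg)

lemma cod_nonneg: "0 \<le> cod X u v"
  unfolding cod_def by (intro sum_nonneg mult_nonneg_nonneg w_nonneg)

lemma cod_Un: "finite X \<Longrightarrow> finite Y \<Longrightarrow> X \<inter> Y = {} \<Longrightarrow> cod (X \<union> Y) u v = cod X u v + cod Y u v"
  unfolding cod_def by (rule sum.union_disjoint)

lemma cod_mono: "finite Y \<Longrightarrow> X \<subseteq> Y \<Longrightarrow> cod X u v \<le> cod Y u v"
  unfolding cod_def by (intro sum_mono2 mult_nonneg_nonneg w_nonneg)

text \<open>Inclusion-exclusion: two vertices with large degrees into the same set have many common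
  neighbours there.\<close>

lemma dg_add_le: "dg X u + dg X v \<le> card X + cod X u v"
proof -
  have "dg X u + dg X v - cod X u v = (\<Sum>z\<in>X. w u z + w v z - w u z * w v z)"
    unfolding dg_def cod_def by (simp add: sum.distrib sum_subtractf)
  also have "\<dots> \<le> (\<Sum>z\<in>X. 1)"
  proof (rule sum_mono)
    fix z show "w u z + w v z - w u z * w v z \<le> 1" using w01[of u z] w01[of v z] by auto
  qed
  finally show ?thesis by simp
qed

lemma sum_dg_swap: "(\<Sum>x\<in>X. dg Y x) = (\<Sum>y\<in>Y. dg X y)"
  unfolding dg_def by (subst sum.swap) (simp add: w_sym)

definition cut :: "'a set \<Rightarrow> real" where
  "cut A = (\<Sum>x\<in>A. dg (V - A) x)"

lemma cut_compl: "A \<subseteq> V \<Longrightarrow> cut (V - A) = cut A"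
  unfolding cut_def by (subst sum_dg_swap) (simp add: double_diff)

text \<open>Moving \<open>x\<close> to the other side changes the cut by
  \<open>dg A x - dg (V - A) x\<close>.\<close>

lemma max_cut_dg_le:
  assumes A: "A \<subseteq> V" "x \<in> A" and max: "cut (A - {x}) \<le> cut A"
  shows "dg A x \<le> dg (V - A) x"
proof -
  have fA: "finite A" using A fin finite_subset by auto
  have xA: "dg {x} y = w x y" for y by (simp add: dg_def w_sym)
  have V: "V - (A - {x}) = (V - A) \<union> {x}" using A by auto
  have "cut (A - {x}) = (\<Sum>y\<in>A - {x}. dg (V - A) y + w x y)"
    unfolding cut_def V using fin A by (intro sum.cong refl) (subst dg_Un, auto simp: xA)
  also have "\<dots> = (\<Sum>y\<in>A. dg (V - A) y + w x y) - (dg (V - A) x + w x x)"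
    using A fA by (simp add: sum_diff1)
  also have "\<dots> = cut A + dg A x - dg (V - A) x"
    by (simp add: w_irrefl sum.distrib cut_def dg_def)
  finally show ?thesis using max by simp
qed

lemma obtain_max_cut:
  obtains A where "A \<subseteq> V" "\<And>X. X \<subseteq> V \<Longrightarrow> cut X \<le> cut A"
proof -
  have fP: "finite (cut ` Pow V)" using fin by simp
  have "Max (cut ` Pow V) \<in> cut ` Pow V" using fP by (intro Max_in) auto
  then obtain A where A: "A \<subseteq> V" "cut A = Max (cut ` Pow V)" by auto
  show ?thesis
  proof (rule that[OF A(1)])
    fix X assume "X \<subseteq> V"
    thus "cut X \<le> cut A" unfolding A(2) using fP by (intro Max_ge) auto
  qed
qed

text \<open>Averaging the cut \<open>(N(u), V - N(u))\<close> over all vertices \<open>u\<close>.\<close>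

lemma max_cut_ge:
  fixes c :: real
  assumes edges: "(real (card V))\<^sup>2 / 2 \<le> (\<Sum>u\<in>V. dg V u)"
    and max: "\<And>X. X \<subseteq> V \<Longrightarrow> cut X \<le> c"
  shows "card V * (\<Sum>u\<in>V. dg V u) / 2 - (\<Sum>u\<in>V. \<Sum>x\<in>V. \<Sum>y\<in>V. w u x * w u y * w x y) \<le> card V * c"
proof -
  let ?n = "real (card V)" and ?e = "\<Sum>u\<in>V. dg V u"
  define N where "N u = {x\<in>V. w u x = 1}" for u
  have sN: "(\<Sum>x\<in>N u. f x) = (\<Sum>x\<in>V. w u x * f x)" for u and f :: "'a \<Rightarrow> real"
  proof -
    have "(\<Sum>x\<in>N u. f x) = (\<Sum>x\<in>V. if w u x = 1 then f x else 0)"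
      unfolding N_def using fin by (simp add: sum.inter_filter)
    also have "\<dots> = (\<Sum>x\<in>V. w u x * f x)"
      by (rule sum.cong) (use w01 in force)+
    finally show ?thesis .
  qed
  have "cut (N u) = (\<Sum>x\<in>V. w u x * dg V x) - (\<Sum>x\<in>V. \<Sum>y\<in>V. w u x * w u y * w x y)" for u
  proof -
    have "cut (N u) = (\<Sum>x\<in>N u. dg V x - dg (N u) x)"
      unfolding cut_def using fin by (intro sum.cong refl dg_Diff) (auto simp: N_def)
    also have "\<dots> = (\<Sum>x\<in>V. w u x * (dg V x - (\<Sum>y\<in>V. w u y * w x y)))"
      unfolding sN by (simp add: dg_def sN)
    finally show ?thesis
      by (simp add: right_diff_distrib sum_subtractf sum_distrib_left mult.assoc)
  qed
  moreover have "(\<Sum>u\<in>V. \<Sum>x\<in>V. w u x * dg V x) = (\<Sum>x\<in>V. (dg V x)\<^sup>2)"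
    by (subst sum.swap) (simp add: dg_def w_sym power2_eq_square sum_distrib_right)
  ultimately have "(\<Sum>u\<in>V. cut (N u))
      = (\<Sum>x\<in>V. (dg V x)\<^sup>2) - (\<Sum>u\<in>V. \<Sum>x\<in>V. \<Sum>y\<in>V. w u x * w u y * w x y)"
    by (simp add: sum_subtractf)
  moreover have "(\<Sum>u\<in>V. cut (N u)) \<le> ?n * c"
    using sum_bounded_above[of V "\<lambda>u. cut (N u)" c] max by (simp add: N_def)
  \<comment> \<open>Expanding the squares around \<open>n / 2\<close> gives the bound
    \<open>?n * ?e - ?n^3 / 4\<close>; the edge hypothesis bounds the subtracted term by half of the
    first.\<close>
  moreover have "?n * ?e / 2 \<le> (\<Sum>x\<in>V. (dg V x)\<^sup>2)"
  proof -
    have "0 \<le> (\<Sum>x\<in>V. (dg V x - ?n / 2)\<^sup>2)" by (intro sum_nonneg) simp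
    also have "\<dots> = (\<Sum>x\<in>V. (dg V x)\<^sup>2 - ?n * dg V x + ?n\<^sup>2 / 4)"
      by (intro sum.cong refl) (simp add: field_simps power2_eq_square)
    also have "\<dots> = (\<Sum>x\<in>V. (dg V x)\<^sup>2) - ?n * ?e + ?n * ?n\<^sup>2 / 4"
      by (simp add: sum.distrib sum_subtractf sum_distrib_left)
    finally have "?n * ?e - ?n * ?n\<^sup>2 / 4 \<le> (\<Sum>x\<in>V. (dg V x)\<^sup>2)" by simp
    moreover have "?n * (?n\<^sup>2 / 2) \<le> ?n * ?e" using edges by (intro mult_left_mono) auto
    ultimately show ?thesis by simp
  qed
  ultimately show ?thesis by simp
qed

end

subsection \<open>Graphs with few inner edges and small books\<close>

text \<open>\<open>k\<close> stands for \<open>n - 4b\<close>. The left side of \<open>inner\<close>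
  is the number of edges inside the two sides. Of the maximality of the cut, only stability under
  moving one vertex is recorded.\<close>

locale book_cut = weighted_graph V w for V :: "'a set" and w +
  fixes A :: "'a set" and b k :: real
  assumes A: "A \<subseteq> V"
    and A_max: "x \<in> A \<Longrightarrow> dg A x \<le> dg (V - A) x" "x \<in> V - A \<Longrightarrow> dg (V - A) x \<le> dg A x"
    and k: "0 < k" "124 * k \<le> b" and card_V: "card V = 4 * b + k"
    and edges: "(real (card V))\<^sup>2 / 2 \<le> (\<Sum>u\<in>V. dg V u)"
    and inner: "(\<Sum>u\<in>V. dg V u) / 2 - cut A \<le> 3 / 2 * b * k"
    and codeg: "u \<in> V \<Longrightarrow> v \<in> V \<Longrightarrow> w u v = 1 \<Longrightarrow> cod V u v \<le> b"
begin

text \<open>If neither end of an edge inside \<open>X\<close> were in \<open>low X\<close>, the edge would have more than \<open>b\<close> common neighbours.\<close>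

definition low :: "'a set \<Rightarrow> 'a set" where
  "low X = {x\<in>X. 2 * dg (V - X) x \<le> card (V - X) + b}"

definition P :: "'a set" where "P = A - low A"
definition Q :: "'a set" where "Q = V - A - low (V - A)"
definition H :: "'a set" where "H = low A \<union> low (V - A)"

text \<open>The assumptions are symmetric in the two sides, so facts proved for \<open>A\<close>
  transfer to \<open>V - A\<close>.\<close>

lemma flip: "book_cut V w (V - A) b k"
  using A A_max k card_V edges inner codeg
  by unfold_locales (auto simp: double_diff cut_compl)

lemma b_pos: "0 < b" using k by simp

lemma finA: "finite A" using A fin finite_subset by blast

lemma finP: "finite P" and finQ: "finite Q" and finH: "finite H"
  using fin finA by (auto simp: P_def Q_def H_def low_def)

lemma low_subset: "low X \<subseteq> X" by (auto simp: low_def)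

lemma V_eq: "P \<union> Q \<union> H = V"
  using A low_subset[of A] low_subset[of "V - A"] by (auto simp: P_def Q_def H_def)

lemma disj: "P \<inter> Q = {}" "P \<inter> H = {}" "Q \<inter> H = {}"
  using A low_subset[of A] low_subset[of "V - A"] by (auto simp: P_def Q_def H_def)

lemma subV: "P \<subseteq> V" "Q \<subseteq> V" "H \<subseteq> V" using V_eq by auto

lemma card_sum: "real (card P) + card Q + card H = 4 * b + k"
proof -
  have "card (P \<union> Q \<union> H) = card P + card Q + card H"
    using disj finP finQ finH by (simp add: card_Un_disjoint Int_Un_distrib2)
  thus ?thesis using card_V by (simp add: V_eq)
qed

section \<open>Sizes of the two sides and of the exceptional set\<close>

lemma card_A_compl: "real (card A) + card (V - A) = 4 * b + k"
  using card_V card_Diff_subset[OF finA A] card_mono[OF fin A] by simp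

text \<open>At least \<open>n^2 / 4\<close> edges exist and all but \<open>3 / 2 * b * k\<close> of
  them cross, while the product of the side sizes is \<open>n^2 / 4\<close> minus the squared
  half-difference.\<close>

lemma missing_bound:
  "card A * card (V - A) - cut A + ((real (card A) - card (V - A)) / 2)\<^sup>2 \<le> 3 / 2 * b * k"
proof -
  have "(4 * b + k)\<^sup>2 / 4 = card A * card (V - A) + ((real (card A) - card (V - A)) / 2)\<^sup>2"
    unfolding card_A_compl[symmetric] by (simp add: field_simps power2_eq_square)
  thus ?thesis using edges inner unfolding card_V by linarith
qed

lemma cut_le: "cut A \<le> card A * card (V - A)"
proof -
  have "cut A \<le> (\<Sum>x\<in>A. card (V - A))" unfolding cut_def of_nat_sum by (intro sum_mono dg_le_card)
  thus ?thesis by simp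
qed

text \<open>\<open>121 / 10000\<close> is \<open>3 / 2\<close> divided by 124, rounded up to the
  square of \<open>11 / 100\<close>.\<close>

lemma bk: "3 / 2 * b * k \<le> 121 / 10000 * b\<^sup>2"
proof -
  have "b * (124 * k) \<le> b * b" using k b_pos by (intro mult_left_mono) auto
  thus ?thesis using b_pos by (simp add: power2_eq_square)
qed

lemma card_compl_bounds: "189 / 100 * b \<le> card (V - A)" "card (V - A) \<le> 2115 / 1000 * b"
proof -
  let ?d = "(real (card A) - card (V - A)) / 2"
  have "?d\<^sup>2 \<le> (11 / 100 * b)\<^sup>2"
    using missing_bound cut_le bk by (simp add: power2_eq_square)
  hence "\<bar>?d\<bar> \<le> 11 / 100 * b"
    using b_pos by (simp add: abs_le_square_iff[symmetric])
  hence "?d \<le> 11 / 100 * b" "- ?d \<le> 11 / 100 * b" by linarith+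
  thus "189 / 100 * b \<le> card (V - A)" "card (V - A) \<le> 2115 / 1000 * b"
    using card_A_compl k by argo+
qed

text \<open>A vertex of \<open>low A\<close> misses at least half of \<open>card (V - A) - b\<close>
  vertices across, and \<open>(1.89 - 1) / 2 = 0.445\<close>.\<close>

lemma card_low: "card (low A) * (445 / 1000 * b) \<le> card A * card (V - A) - cut A"
proof -
  have "card (low A) * (445 / 1000 * b) = (\<Sum>x\<in>low A. 445 / 1000 * b)" by simp
  also have "\<dots> \<le> (\<Sum>x\<in>low A. card (V - A) - dg (V - A) x)"
    using card_compl_bounds by (intro sum_mono) (simp add: low_def)
  also have "\<dots> \<le> (\<Sum>x\<in>A. card (V - A) - dg (V - A) x)"
    using finA low_subset[of A] dg_le_card by (intro sum_mono2) auto
  also have "\<dots> = card A * card (V - A) - cut A" by (simp add: sum_subtractf cut_def)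
  finally show ?thesis .
qed

lemma card_H: "card H \<le> 11 / 200 * b"
proof -
  have "card (low (V - A)) * (445 / 1000 * b) \<le> card A * card (V - A) - cut A"
    using book_cut.card_low[OF flip] A by (simp add: double_diff cut_compl mult.commute)
  moreover have "real (card H) \<le> card (low A) + card (low (V - A))"
    unfolding H_def using card_Un_le[of "low A" "low (V - A)"] by linarith
  hence "card H * (445 / 1000 * b) \<le> (real (card (low A)) + card (low (V - A))) * (445 / 1000 * b)"
    using b_pos by (intro mult_right_mono) auto
  moreover have "card A * card (V - A) - cut A \<le> 121 / 10000 * b\<^sup>2"
    using missing_bound bk zero_le_power2[of "(real (card A) - card (V - A)) / 2"] by linarith
  ultimately have "card H * (445 / 1000 * b) \<le> 242 / 10000 * b * b"
    using card_low by (simp add: power2_eq_square distrib_right)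
  thus ?thesis using b_pos by simp
qed

lemma indep_P: "u \<in> P \<Longrightarrow> v \<in> P \<Longrightarrow> w u v = 0"
proof (rule ccontr)
  assume uv: "u \<in> P" "v \<in> P" "w u v \<noteq> 0"
  hence "cod V u v \<le> b" using codeg w01[of u v] subV by blast
  moreover have "cod (V - A) u v \<le> cod V u v" using fin by (intro cod_mono) auto
  ultimately show False using dg_add_le[of "V - A" u v] uv by (auto simp: P_def low_def)
qed

lemma indep_Q: "u \<in> Q \<Longrightarrow> v \<in> Q \<Longrightarrow> w u v = 0"
  using book_cut.indep_P[OF flip, of u v] by (auto simp: Q_def book_cut.P_def[OF flip] book_cut.low_def[OF flip] low_def)

text \<open>By lowness and cut maximality, \<open>dg P x\<close> and \<open>dg Q x\<close> are both
  at most about \<open>1.56 * b\<close>. A small \<open>dg P x\<close> adds at most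
  \<open>b / 6\<close>; a small \<open>dg Q x\<close> makes \<open>dg (V - A) x\<close> small, as
  \<open>H\<close> is small, and hence also \<open>dg A x\<close>.\<close>

lemma low_A_type:
  assumes x: "x \<in> low A"
  shows "(b / 6 \<le> dg P x \<and> b / 6 \<le> dg Q x) \<or> dg P x + dg Q x \<le> 173 / 100 * b"
proof -
  have "dg Q x \<le> dg (V - A) x" using fin by (intro dg_mono) (auto simp: Q_def)
  moreover have "dg P x \<le> dg A x" using finA by (intro dg_mono) (auto simp: P_def)
  moreover have "dg A x \<le> dg (V - A) x" using x low_subset A_max by blast
  moreover have "dg (V - A) x \<le> dg Q x + card H"
  proof -
    have "dg (V - A) x = dg Q x + dg (low (V - A)) x"
      using low_subset[of "V - A"] fin finite_subset[OF low_subset] unfolding Q_def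
      by (subst dg_Un[symmetric]) (auto simp: Un_absorb2)
    moreover have "dg (low (V - A)) x \<le> card H"
      using dg_le_card[of "low (V - A)" x] card_mono[OF finH, of "low (V - A)"] by (auto simp: H_def)
    ultimately show ?thesis by simp
  qed
  moreover have "2 * dg (V - A) x \<le> card (V - A) + b" using x by (simp add: low_def)
  ultimately show ?thesis using card_compl_bounds card_H b_pos by linarith
qed

lemma H_type:
  assumes x: "x \<in> H"
  shows "(b / 6 \<le> dg P x \<and> b / 6 \<le> dg Q x) \<or> dg P x + dg Q x \<le> 173 / 100 * b"
proof (cases "x \<in> low A")
  case False
  hence "x \<in> low (V - A)" using x by (auto simp: H_def)
  moreover have "book_cut.P V w (V - A) b = Q" "book_cut.Q V w (V - A) b = P"
    using A by (simp_all add: Q_def P_def book_cut.P_def[OF flip] book_cut.Q_def[OF flip]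
        book_cut.low_def[OF flip] low_def double_diff)
  ultimately show ?thesis
    using book_cut.low_A_type[OF flip, of x] by (auto simp: book_cut.low_def[OF flip] low_def)
qed (rule low_A_type)

text \<open>
  \<open>CP x + CQ x\<close> counts the triangles that contain \<open>x\<close>, a second vertex of \<open>H\<close> and a vertex outside \<open>H\<close>.
\<close>

definition tri :: "'a \<Rightarrow> real" where
  "tri x = (\<Sum>u\<in>P. \<Sum>v\<in>Q. w x u * w x v * w u v)"

definition mis :: real where
  "mis = (\<Sum>u\<in>P. \<Sum>v\<in>Q. 1 - w u v)"

definition CP :: "'a \<Rightarrow> real" where "CP x = (\<Sum>u\<in>P. w x u * cod H x u)"
definition CQ :: "'a \<Rightarrow> real" where "CQ x = (\<Sum>u\<in>Q. w x u * cod H x u)"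

section \<open>Triangles at a vertex and missing pairs between \<open>P\<close> and
  \<open>Q\<close>\<close>

lemma tri_nonneg: "0 \<le> tri x" "0 \<le> CP x" "0 \<le> CQ x"
  unfolding tri_def CP_def CQ_def by (intro sum_nonneg mult_nonneg_nonneg w_nonneg cod_nonneg)+

lemma tri_eq: "dg P x * dg Q x - tri x = (\<Sum>u\<in>P. \<Sum>v\<in>Q. w x u * w x v * (1 - w u v))"
  unfolding dg_def tri_def by (simp add: sum_product right_diff_distrib sum_subtractf)

text \<open>The difference counts nonadjacent pairs between the neighbourhoods of \<open>x\<close>
  in \<open>P\<close> and \<open>Q\<close>; it serves as the \<open>M\<close> of
  \<open>bad_vertex_estimates\<close>.\<close>

lemma lost_bounds: "0 \<le> dg P x * dg Q x - tri x" "dg P x * dg Q x - tri x \<le> mis"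
proof -
  show "0 \<le> dg P x * dg Q x - tri x" unfolding tri_eq
    by (intro sum_nonneg mult_nonneg_nonneg w_nonneg) (simp add: w_le_1)
  have *: "w x u * w x v * (1 - w u v) \<le> 1 - w u v" for u v
    using w01[of x u] w01[of x v] w_le_1[of u v] by auto
  show "dg P x * dg Q x - tri x \<le> mis" unfolding tri_eq mis_def by (intro sum_mono *)
qed

lemma mis_nonneg: "0 \<le> mis"
  unfolding mis_def by (intro sum_nonneg) (simp add: w_le_1)

lemma mis_eq: "mis = card P * card Q - (\<Sum>u\<in>P. dg Q u)"
  unfolding mis_def dg_def by (simp add: sum_subtractf)

lemma mis_le: "mis \<le> 121 / 10000 * b\<^sup>2"
proof -
  have "mis \<le> (\<Sum>u\<in>A. \<Sum>v\<in>Q. 1 - w u v)"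
    unfolding mis_def using finA by (intro sum_mono2 sum_nonneg) (auto simp: P_def w_le_1)
  also have "\<dots> \<le> (\<Sum>u\<in>A. \<Sum>v\<in>V - A. 1 - w u v)"
    using fin by (intro sum_mono sum_mono2) (auto simp: Q_def w_le_1)
  also have "\<dots> = card A * card (V - A) - cut A" by (simp add: sum_subtractf cut_def dg_def)
  finally show ?thesis
    using missing_bound bk zero_le_power2[of "(real (card A) - card (V - A)) / 2"] by linarith
qed

text \<open>The book condition summed over the edges from \<open>x\<close> to \<open>P\<close>,
  keeping only common neighbours in \<open>Q\<close> and \<open>H\<close>.\<close>

lemma codeg_P: "x \<in> V \<Longrightarrow> tri x + CP x \<le> b * dg P x"
proof -
  assume x: "x \<in> V"
  have "tri x + CP x = (\<Sum>u\<in>P. w x u * (cod Q x u + cod H x u))"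
    unfolding tri_def CP_def cod_def by (simp add: sum.distrib distrib_left sum_distrib_left mult.assoc)
  also have "\<dots> \<le> (\<Sum>u\<in>P. w x u * b)"
  proof (rule sum_mono)
    fix u assume u: "u \<in> P"
    show "w x u * (cod Q x u + cod H x u) \<le> w x u * b"
    proof (cases "w x u = 1")
      case True
      have "cod Q x u + cod H x u \<le> cod V x u"
        unfolding cod_Un[OF finQ finH disj(3), symmetric] using fin subV by (intro cod_mono) auto
      also have "\<dots> \<le> b" using codeg x u True subV by blast
      finally show ?thesis using True by simp
    qed (use w01[of x u] in simp)
  qed
  finally show ?thesis by (simp add: dg_def sum_distrib_left mult.commute)
qed

lemma codeg_Q: "x \<in> V \<Longrightarrow> tri x + CQ x \<le> b * dg Q x"
proof -
  assume x: "x \<in> V"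
  have "tri x + CQ x = (\<Sum>u\<in>Q. w x u * (cod P x u + cod H x u))"
    unfolding tri_def CQ_def cod_def
    by (subst sum.swap) (simp add: sum.distrib distrib_left sum_distrib_left w_sym mult_ac)
  also have "\<dots> \<le> (\<Sum>u\<in>Q. w x u * b)"
  proof (rule sum_mono)
    fix u assume u: "u \<in> Q"
    show "w x u * (cod P x u + cod H x u) \<le> w x u * b"
    proof (cases "w x u = 1")
      case True
      have "cod P x u + cod H x u \<le> cod V x u"
        unfolding cod_Un[OF finP finH disj(2), symmetric] using fin subV by (intro cod_mono) auto
      also have "\<dots> \<le> b" using codeg x u True subV by blast
      finally show ?thesis using True by simp
    qed (use w01[of x u] in simp)
  qed
  finally show ?thesis by (simp add: dg_def sum_distrib_left mult.commute)
qed

text \<open>Double counting: the same triangles are grouped by their edge \<open>xz\<close> inside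
  \<open>H\<close> instead of by their vertex outside.\<close>

lemma CPQ_eq: "CP x + CQ x = (\<Sum>z\<in>H. w x z * cod (P \<union> Q) x z)"
proof -
  have "CP x + CQ x = (\<Sum>u\<in>P \<union> Q. w x u * cod H x u)"
    unfolding CP_def CQ_def using finP finQ disj by (simp add: sum.union_disjoint)
  also have "\<dots> = (\<Sum>z\<in>H. w x z * cod (P \<union> Q) x z)"
    unfolding cod_def sum_distrib_left by (subst sum.swap) (simp add: w_sym mult_ac)
  finally show ?thesis .
qed

lemma CPQ_le:
  assumes "x \<in> V" shows "CP x + CQ x \<le> 11 / 200 * b\<^sup>2"
proof -
  have "CP x + CQ x \<le> (\<Sum>z\<in>H. b)"
    unfolding CPQ_eq
  proof (rule sum_mono)
    fix z assume z: "z \<in> H"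
    show "w x z * cod (P \<union> Q) x z \<le> b"
    proof (cases "w x z = 1")
      case True
      have "cod (P \<union> Q) x z \<le> cod V x z" using fin subV by (intro cod_mono) auto
      also have "\<dots> \<le> b" using codeg True assms z subV by blast
      finally show ?thesis using True by simp
    qed (use w01[of x z] b_pos in simp)
  qed
  also have "\<dots> = card H * b" by simp
  also have "\<dots> \<le> (11 / 200 * b) * b" using card_H b_pos by (intro mult_right_mono) auto
  finally show ?thesis by (simp add: power2_eq_square)
qed

lemma dg_V: "dg V x = dg P x + dg Q x + dg H x"
proof -
  have "dg (P \<union> Q \<union> H) x = dg P x + dg Q x + dg H x"
    using finP finQ finH disj by (simp add: dg_Un Int_Un_distrib2)
  thus ?thesis by (simp add: V_eq)
qed

lemma sum_dg_V: "(\<Sum>x\<in>V. dg V x) = 2 * (card P * card Q - mis) + 2 * (\<Sum>x\<in>H. dg P x + dg Q x) + (\<Sum>x\<in>H. dg H x)"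
proof -
  have z: "(\<Sum>x\<in>P. dg P x) = 0" "(\<Sum>x\<in>Q. dg Q x) = 0"
    unfolding dg_def using indep_P indep_Q by (auto intro!: sum.neutral)
  have s: "(\<Sum>x\<in>V. f x) = (\<Sum>x\<in>P. f x) + (\<Sum>x\<in>Q. f x) + (\<Sum>x\<in>H. f x)" for f :: "'a \<Rightarrow> real"
  proof -
    have "(\<Sum>x\<in>P \<union> Q \<union> H. f x) = (\<Sum>x\<in>P. f x) + (\<Sum>x\<in>Q. f x) + (\<Sum>x\<in>H. f x)"
      using finP finQ finH disj by (simp add: sum.union_disjoint Int_Un_distrib2)
    thus ?thesis by (simp add: V_eq)
  qed
  show ?thesis
    unfolding s dg_V sum.distrib z mis_eq
    using sum_dg_swap[of Q P] sum_dg_swap[of H P] sum_dg_swap[of H Q] by simp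
qed

text \<open>Mantel's bound for the edges of \<open>H\<close> separated by the neighbourhood of \<open>v\<close>.\<close>

lemma edges_H_le:
  "(\<Sum>x\<in>H. dg H x) \<le> (real (card H))\<^sup>2 / 2
     + (\<Sum>x\<in>H. \<Sum>z\<in>H. w x z * (1 - w v x - w v z + 2 * w v x * w v z))"
proof -
  let ?s = "dg H v" and ?h = "real (card H)"
  \<comment> \<open>For 0/1 values, \<open>1 - a - c + 2 * a * c\<close> indicates
    \<open>a = c\<close>. What remains are the ordered edges with exactly one end adjacent to
    \<open>v\<close>.\<close>
  have "(\<Sum>x\<in>H. dg H x) - (\<Sum>x\<in>H. \<Sum>z\<in>H. w x z * (1 - w v x - w v z + 2 * w v x * w v z))
    = (\<Sum>x\<in>H. \<Sum>z\<in>H. w x z * (w v x * (1 - w v z) + (1 - w v x) * w v z))"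
    unfolding dg_def sum_subtractf[symmetric] by (intro sum.cong refl) (simp add: algebra_simps)
  also have "\<dots> \<le> (\<Sum>x\<in>H. \<Sum>z\<in>H. w v x * (1 - w v z) + (1 - w v x) * w v z)"
  proof (intro sum_mono)
    fix x z show "w x z * (w v x * (1 - w v z) + (1 - w v x) * w v z)
      \<le> w v x * (1 - w v z) + (1 - w v x) * w v z"
      using w01[of x z] w01[of v x] w01[of v z] by auto
  qed
  also have "\<dots> = 2 * ?s * (?h - ?s)"
    unfolding dg_def by (simp add: sum.distrib sum_distrib_left[symmetric] sum_distrib_right[symmetric]
        sum_subtractf algebra_simps)
  also have "\<dots> \<le> ?h\<^sup>2 / 2"
    using zero_le_power2[of "?h - 2 * ?s"] by (simp add: power2_eq_square algebra_simps)
  finally show ?thesis by simp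
qed

text \<open>Summing the previous correction term over all \<open>v\<close> outside \<open>H\<close>
  turns its product term into triangles with two vertices in \<open>H\<close>. This yields
  assumption \<open>Y\<close> of \<open>bad_set_estimates\<close>.\<close>

lemma sum_edges_H:
  "(\<Sum>v\<in>P \<union> Q. \<Sum>x\<in>H. \<Sum>z\<in>H. w x z * (1 - w v x - w v z + 2 * w v x * w v z))
    = card (P \<union> Q) * (\<Sum>x\<in>H. dg H x) - 2 * (\<Sum>x\<in>H. dg H x * (dg P x + dg Q x)) + 2 * (\<Sum>x\<in>H. CP x + CQ x)"
proof -
  let ?W = "P \<union> Q"
  have W: "dg P x + dg Q x = dg ?W x" for x using finP finQ disj by (simp add: dg_Un)
  have "(\<Sum>v\<in>?W. \<Sum>x\<in>H. \<Sum>z\<in>H. w x z * (1 - w v x - w v z + 2 * w v x * w v z))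
    = (\<Sum>x\<in>H. \<Sum>z\<in>H. \<Sum>v\<in>?W. w x z * (1 - w v x - w v z + 2 * w v x * w v z))"
    by (rule trans[OF sum.swap]) (rule sum.cong[OF refl sum.swap])
  also have "\<dots> = (\<Sum>x\<in>H. \<Sum>z\<in>H. card ?W * w x z - w x z * dg ?W x - w x z * dg ?W z + 2 * (w x z * cod ?W x z))"
    by (intro sum.cong refl)
      (simp add: dg_def cod_def sum.distrib sum_subtractf sum_distrib_left algebra_simps w_sym)
  also have "\<dots> = card ?W * (\<Sum>x\<in>H. dg H x) - (\<Sum>x\<in>H. dg H x * dg ?W x)
      - (\<Sum>x\<in>H. \<Sum>z\<in>H. w x z * dg ?W z) + 2 * (\<Sum>x\<in>H. CP x + CQ x)"
    unfolding CPQ_eq sum.distrib sum_subtractf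
    by (simp add: dg_def[of H] sum_distrib_left sum_distrib_right)
  also have "(\<Sum>x\<in>H. \<Sum>z\<in>H. w x z * dg ?W z) = (\<Sum>x\<in>H. dg H x * dg ?W x)"
    by (subst sum.swap) (simp add: dg_def sum_distrib_right w_sym)
  finally show ?thesis by (simp add: W)
qed

text \<open>The two numerical lemmas are applied to the graph: the vertex estimates are summed over
  \<open>H\<close>, and the conclusion of \<open>bad_set_estimates\<close> makes the nonnegative
  terms \<open>E x\<close> and \<open>M x\<close> vanish.\<close>

lemma extremal_counts:
  assumes H: "H \<noteq> {}" and few: "(\<Sum>x\<in>H. tri x) \<le> b\<^sup>2 * k"
  shows "card H = k" "mis = 0" "card P = card Q" "(\<Sum>x\<in>H. dg H x) = k\<^sup>2 / 2"
    "(\<Sum>x\<in>H. tri x) = b\<^sup>2 * k" "x \<in> H \<Longrightarrow> dg P x = b \<and> dg Q x = b \<and> CP x + CQ x = 0"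
proof -
  let ?h = "real (card H)" and ?F = "\<Sum>x\<in>H. dg H x"
  define M where "M x = dg P x * dg Q x - tri x" for x
  define E where "E x = 2 * b - dg P x - dg Q x + 12 * M x / b" for x
  have M: "0 \<le> M x" "M x \<le> mis" for x unfolding M_def by (rule lost_bounds)+
  have est: "0 \<le> E x" "CP x + CQ x \<le> 23 / 20 * b * E x + 3 * M x" "b\<^sup>2 - 4 * b * E x - 2 * M x \<le> tri x"
    "E x = 0 \<Longrightarrow> M x = 0 \<Longrightarrow> dg P x = b \<and> dg Q x = b" if "x \<in> H" for x
  proof -
    have "x \<in> V" using that subV by auto
    note * = bad_vertex_estimates[of b "M x" "tri x" "dg P x" "dg Q x" "CP x" "CQ x" "E x"]
    note ** = *[OF b_pos M(1) order_trans[OF M(2)] _ tri_nonneg codeg_P[OF \<open>x \<in> V\<close>] codeg_Q[OF \<open>x \<in> V\<close>]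
        _ _ E_def]
    show "0 \<le> E x" "CP x + CQ x \<le> 23 / 20 * b * E x + 3 * M x" "b\<^sup>2 - 4 * b * E x - 2 * M x \<le> tri x"
      "E x = 0 \<Longrightarrow> M x = 0 \<Longrightarrow> dg P x = b \<and> dg Q x = b"
      using ** mis_le CPQ_le[OF \<open>x \<in> V\<close>] H_type[OF that] by (simp_all add: M_def)
  qed
  define Es where "Es = (\<Sum>x\<in>H. E x)"
  define MS where "MS = (\<Sum>x\<in>H. M x)"
  have h0: "0 < ?h" using H finH by (simp add: card_gt_0_iff)
  have N: "real (card (P \<union> Q)) = 4 * b + k - ?h"
    using card_sum disj(1) finP finQ by (simp add: card_Un_disjoint)
  have MS: "0 \<le> MS" "MS \<le> ?h * mis"
    unfolding MS_def using M sum_bounded_above[of H M mis] by (auto intro: sum_nonneg)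
  have Es: "Es = 2 * b * ?h - (\<Sum>x\<in>H. dg P x + dg Q x) + 12 * MS / b" "0 \<le> Es"
  proof -
    show "Es = 2 * b * ?h - (\<Sum>x\<in>H. dg P x + dg Q x) + 12 * MS / b"
      by (simp add: Es_def MS_def E_def sum.distrib sum_subtractf sum_distrib_left sum_divide_distrib)
    show "0 \<le> Es" unfolding Es_def using est(1) by (intro sum_nonneg)
  qed
  have F: "0 \<le> ?F" "?F \<le> ?h\<^sup>2"
    using sum_bounded_above[of H "dg H" ?h] dg_le_card[of H]
    by (auto intro: sum_nonneg simp: dg_nonneg power2_eq_square)
  have Y: "(4 * b + k - ?h) * (?F - ?h\<^sup>2 / 2) \<le> (4 * b + k - ?h) * ?F
      - 2 * (\<Sum>x\<in>H. dg H x * (dg P x + dg Q x)) + 2 * (\<Sum>x\<in>H. CP x + CQ x)"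
  proof -
    have "(\<Sum>v\<in>P \<union> Q. ?F - ?h\<^sup>2 / 2)
      \<le> (\<Sum>v\<in>P \<union> Q. \<Sum>x\<in>H. \<Sum>z\<in>H. w x z * (1 - w v x - w v z + 2 * w v x * w v z))"
      using edges_H_le by (intro sum_mono) (simp add: diff_le_eq add.commute)
    thus ?thesis unfolding sum_edges_H by (simp add: N)
  qed
  have X: "2 * b * ?F - ?h * Es \<le> (\<Sum>x\<in>H. dg H x * (dg P x + dg Q x))"
  proof -
    have "2 * b * ?F - ?h * Es = (\<Sum>x\<in>H. dg H x * (2 * b) - ?h * E x)"
      by (simp add: Es_def sum_subtractf sum_distrib_left sum_distrib_right mult_ac)
    also have "\<dots> \<le> (\<Sum>x\<in>H. dg H x * (dg P x + dg Q x))"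
    proof (rule sum_mono)
      fix x assume x: "x \<in> H"
      have "0 \<le> M x / b" using M b_pos by simp
      hence "dg H x * (2 * b - E x) \<le> dg H x * (dg P x + dg Q x)"
        by (intro mult_left_mono dg_nonneg) (simp add: E_def)
      moreover have "dg H x * E x \<le> ?h * E x"
        using est(1)[OF x] by (intro mult_right_mono dg_le_card)
      ultimately show "dg H x * (2 * b) - ?h * E x \<le> dg H x * (dg P x + dg Q x)"
        by (simp add: right_diff_distrib)
    qed
    finally show ?thesis .
  qed
  have CS: "(\<Sum>x\<in>H. CP x + CQ x) \<le> 23 / 20 * b * Es + 3 * MS"
    unfolding Es_def MS_def sum_distrib_left sum.distrib[symmetric]
    using est(2) by (intro sum_mono) (simp add: mult.assoc)
  have ts: "?h * b\<^sup>2 - 4 * b * Es - 2 * MS \<le> (\<Sum>x\<in>H. tri x)"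
  proof -
    have "?h * b\<^sup>2 - 4 * b * Es - 2 * MS = (\<Sum>x\<in>H. b\<^sup>2 - 4 * b * E x - 2 * M x)"
      by (simp add: Es_def MS_def sum_subtractf sum_distrib_left)
    also have "\<dots> \<le> (\<Sum>x\<in>H. tri x)" using est(3) by (intro sum_mono) simp
    finally show ?thesis .
  qed
  have main: "?h = k \<and> Es = 0 \<and> mis = 0 \<and> real (card P) = real (card Q) \<and> ?F = ?h\<^sup>2 / 2"
    by (rule bad_set_estimates[OF b_pos h0 card_H k(1) refl _ mis_nonneg F _ MS Es Y X CS ts few])
      (use card_sum edges in \<open>simp_all add: sum_dg_V card_V\<close>)
  thus "card H = k" "mis = 0" "card P = card Q" "(\<Sum>x\<in>H. dg H x) = k\<^sup>2 / 2" by auto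
  have MS0: "MS = 0" using main MS by simp
  show "(\<Sum>x\<in>H. tri x) = b\<^sup>2 * k" using ts few main MS0 by (simp add: mult.commute)
  assume x: "x \<in> H"
  have "M x = 0" "E x = 0"
    using x main MS0 finH M est(1) unfolding Es_def MS_def by (simp_all add: sum_nonneg_eq_0_iff)
  thus "dg P x = b \<and> dg Q x = b \<and> CP x + CQ x = 0"
    using est(2,4)[OF x] tri_nonneg[of x] by simp
qed

section \<open>Reconstruction of the graph in the equality case\<close>

lemma mis_zeroD:
  assumes "mis = 0" and uv: "u \<in> P" "v \<in> Q"
  shows "w u v = 1"
proof -
  have "\<forall>u\<in>P. (\<Sum>v\<in>Q. 1 - w u v) = 0"
    using assms(1) finP unfolding mis_def by (subst (asm) sum_nonneg_eq_0_iff) (auto intro!: sum_nonneg simp: w_le_1)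
  hence "(\<Sum>v\<in>Q. 1 - w u v) = 0" using uv by blast
  thus ?thesis using uv finQ by (subst (asm) sum_nonneg_eq_0_iff) (auto simp: w_le_1)
qed

text \<open>Equality in the averaged Mantel bound means that every vertex outside \<open>H\<close>
  sees exactly one end of every edge in \<open>H\<close>. One neighbourhood then splits
  \<open>H\<close> into a balanced complete bipartite graph, and each outside vertex is classified
  by its adjacency to a single \<open>x0\<close>.\<close>

lemma extremal_structure:
  assumes H: "H \<noteq> {}" and few: "(\<Sum>x\<in>H. tri x) \<le> b\<^sup>2 * k"
  obtains part :: "'a \<Rightarrow> prism_vertex" where
    "\<And>u v. u \<in> V \<Longrightarrow> v \<in> V \<Longrightarrow> w u v = 1 \<longleftrightarrow> {part u, part v} \<in> prism_edges"
    "\<And>p. card {v\<in>V. part v = p} = (if p = U3 \<or> p = V3 then k / 2 else b)"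
proof -
  note E = extremal_counts[OF H few]
  let ?h = "real (card H)" and ?F = "\<Sum>x\<in>H. dg H x" and ?W = "P \<union> Q"
  have cP: "card P = 2 * b" and cQ: "card Q = 2 * b" using card_sum E(1,3) by simp_all
  have cW: "card ?W = 4 * b" using cP cQ disj(1) finP finQ by (simp add: card_Un_disjoint)
  note PQ = mis_zeroD[OF E(2)]
  define R where "R v x z = w x z * (1 - w v x - w v z + 2 * w v x * w v z)" for v x z
  have R0: "0 \<le> R v x z" for v x z
    unfolding R_def using w01[of x z] w01[of v x] w01[of v z] by auto
  have "(\<Sum>x\<in>H. dg H x * (dg P x + dg Q x)) = (\<Sum>x\<in>H. dg H x * (2 * b))"
    using E(6) by (intro sum.cong refl) simp
  \<comment> \<open>Each vertex of \<open>H\<close> has \<open>2 * b\<close> neighbours in each of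
    two directions of counting, which cancels the \<open>4 * b\<close> vertices of
    \<open>?W\<close>; the triangle terms are zero.\<close>
  hence "(\<Sum>v\<in>?W. \<Sum>x\<in>H. \<Sum>z\<in>H. R v x z) = 0"
    using E(6) unfolding R_def sum_edges_H cW by (simp add: sum_distrib_left mult_ac)
  hence "\<forall>v\<in>?W. \<forall>x\<in>H. \<forall>z\<in>H. R v x z = 0"
    using finP finQ finH R0 by (simp add: sum_nonneg_eq_0_iff sum_nonneg del: Un_iff)
  hence compl: "w v z = 1 - w v x" if "v \<in> ?W" "x \<in> H" "z \<in> H" "w x z = 1" for v x z
  proof -
    have "R v x z = 0" using \<open>\<forall>v\<in>?W. _\<close> that by blast
    thus ?thesis using that w01[of v x] w01[of v z] by (auto simp: R_def)
  qed
  have "P \<noteq> {}" using cP b_pos by auto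
  then obtain v0 where v0: "v0 \<in> P" by auto
  define S where "S = {x\<in>H. w v0 x = 1}"
  define T where "T = H - S"
  have ST: "finite S" "finite T" "S \<inter> T = {}" "S \<union> T = H" "S \<subseteq> H" "T \<subseteq> H"
    using finH by (auto simp: S_def T_def)
  have SS: "w x z = 0" if "x \<in> S" "z \<in> S" for x z
    using that compl[of v0 x z] v0 w01[of x z] by (auto simp: S_def)
  have TT: "w x z = 0" if "x \<in> T" "z \<in> T" for x z
    using that compl[of v0 x z] v0 w01[of x z] w01[of v0 x] w01[of v0 z] by (auto simp: S_def T_def)
  have "?F = 2 * (\<Sum>x\<in>S. dg T x)"
  proof -
    have "?F = (\<Sum>x\<in>S. dg S x + dg T x) + (\<Sum>x\<in>T. dg S x + dg T x)"
      using ST dg_Un[OF ST(1-3)] sum.union_disjoint[OF ST(1-3)] by simp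
    moreover have "(\<Sum>x\<in>S. dg S x) = 0" "(\<Sum>x\<in>T. dg T x) = 0"
      unfolding dg_def using SS TT by (auto intro!: sum.neutral)
    ultimately show ?thesis using sum_dg_swap[of S T] by (simp add: sum.distrib)
  qed
  moreover have "(\<Sum>x\<in>S. \<Sum>z\<in>T. 1 - w x z) = real (card S) * card T - (\<Sum>x\<in>S. dg T x)"
    by (simp add: dg_def sum_subtractf)
  moreover have "0 \<le> (\<Sum>x\<in>S. \<Sum>z\<in>T. 1 - w x z)" by (intro sum_nonneg) (simp add: w_le_1)
  moreover have hST: "k = real (card S) + card T"
    using card_Un_disjoint[OF ST(1-3)] E(1) by (simp add: ST)
  moreover have "real (card S) * card T = k\<^sup>2 / 4 - (real (card S) - card T)\<^sup>2 / 4"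
    unfolding hST by (simp add: field_simps power2_eq_square)
  \<comment> \<open>\<open>H\<close> has \<open>k^2 / 4\<close> edges, all between \<open>S\<close>
    and \<open>T\<close>. The identity for \<open>card S * card T\<close> leaves room neither for a
    missing pair nor for an imbalance.\<close>
  ultimately have z: "(\<Sum>x\<in>S. \<Sum>z\<in>T. 1 - w x z) = 0" "(real (card S) - card T)\<^sup>2 = 0"
    using E(4) zero_le_power2[of "real (card S) - card T"] by linarith+
  hence cST: "card S = k / 2" "card T = k / 2" using hST by simp_all
  have STw: "w x z = 1" if "x \<in> S" "z \<in> T" for x z
  proof -
    have "\<forall>x\<in>S. (\<Sum>z\<in>T. 1 - w x z) = 0"
      using z(1) ST by (subst (asm) sum_nonneg_eq_0_iff) (auto intro!: sum_nonneg simp: w_le_1)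
    hence "(\<Sum>z\<in>T. 1 - w x z) = 0" using that by blast
    thus ?thesis using that ST by (subst (asm) sum_nonneg_eq_0_iff) (auto simp: w_le_1)
  qed
  obtain x0 z0 where x0: "x0 \<in> S" and z0: "z0 \<in> T" using cST k by fastforce
  have T: "w v z = 1 - w v x0" if "v \<in> ?W" "z \<in> T" for v z
    using compl[of v x0 z] that x0 STw ST by blast
  have S: "w v x = w v x0" if "v \<in> ?W" "x \<in> S" for v x
  proof -
    have "x \<in> H" "z0 \<in> H" using that z0 ST by auto
    thus ?thesis using compl[of v x z0] T[of v z0] that z0 STw by simp
  qed
  \<comment> \<open>\<open>P\<close> must be independent and complete to \<open>Q\<close>, so it
    consists of the nonadjacent prism parts \<open>U1\<close> and \<open>V2\<close>, and
    \<open>Q\<close> of \<open>U2\<close> and \<open>V1\<close>.\<close>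
  define part where "part u = (if u \<in> S then U3 else if u \<in> T then V3 else
    if u \<in> P then if w u x0 = 1 then U1 else V2 else if w u x0 = 1 then U2 else V1)" for u
  have V: "u \<in> V \<longleftrightarrow> u \<in> P \<or> u \<in> Q \<or> u \<in> S \<or> u \<in> T" for u
    using V_eq ST by blast
  have D: "\<And>u. u \<in> P \<Longrightarrow> u \<notin> Q \<and> u \<notin> S \<and> u \<notin> T" "\<And>u. u \<in> Q \<Longrightarrow> u \<notin> P \<and> u \<notin> S \<and> u \<notin> T"
    "\<And>u. u \<in> S \<Longrightarrow> u \<notin> T"
    using disj ST by blast+
  have pS: "u \<in> S \<Longrightarrow> part u = U3" and pT: "u \<in> T \<Longrightarrow> part u = V3" 
    and pP: "u \<in> P \<Longrightarrow> part u = (if w u x0 = 1 then U1 else V2)" 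
    and pQ: "u \<in> Q \<Longrightarrow> part u = (if w u x0 = 1 then U2 else V1)" for u
    using D[of u] by (auto simp: part_def)
  have PQ': "w u v = 1" if "u \<in> Q" "v \<in> P" for u v using PQ[OF that(2,1)] w_sym by simp
  have ST': "w u v = 1" if "u \<in> T" "v \<in> S" for u v using STw[OF that(2,1)] w_sym by simp
  have S': "w x v = w v x0" if "v \<in> ?W" "x \<in> S" for v x using S[OF that] w_sym by simp
  have T': "w z v = 1 - w v x0" if "v \<in> ?W" "z \<in> T" for v z using T[OF that] w_sym by simp
  show thesis
  proof (rule that[of part])
    fix u v assume uv: "u \<in> V" "v \<in> V"
    consider "u \<in> P" | "u \<in> Q" | "u \<in> S" | "u \<in> T" using uv V by blast
    note cu = this
    consider "v \<in> P" | "v \<in> Q" | "v \<in> S" | "v \<in> T" using uv V by blast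
    thus "w u v = 1 \<longleftrightarrow> {part u, part v} \<in> prism_edges"
      using w01[of u x0] w01[of v x0]
      by (cases; cases rule: cu)
        (auto simp: pS pT pP pQ PQ PQ' STw ST' SS TT S S' T T' indep_P indep_Q prism_edges_def doubleton_eq_iff)
  next
    fix p
    have x0H: "x0 \<in> H" using x0 ST by auto
    have sub: "dg X x0 = card {u\<in>X. w u x0 = 1}" if "finite X" for X
    proof -
      have "dg X x0 = (\<Sum>u\<in>X. if w u x0 = 1 then 1 else 0)"
        unfolding dg_def by (intro sum.cong refl) (metis w01 w_sym)
      thus ?thesis using that by (simp add: sum.inter_filter[symmetric])
    qed
    have compl_card: "card {u\<in>X. w u x0 \<noteq> 1} = card X - dg X x0" if "finite X" for X
    proof -
      have "{u\<in>X. w u x0 \<noteq> 1} = X - {u\<in>X. w u x0 = 1}" by auto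
      thus ?thesis using that card_mono[OF that, of "{u\<in>X. w u x0 = 1}"]
        by (simp add: sub card_Diff_subset of_nat_diff)
    qed
    have "{v\<in>V. part v = U1} = {u\<in>P. w u x0 = 1}" "{v\<in>V. part v = V2} = {u\<in>P. w u x0 \<noteq> 1}"
      "{v\<in>V. part v = U2} = {u\<in>Q. w u x0 = 1}" "{v\<in>V. part v = V1} = {u\<in>Q. w u x0 \<noteq> 1}"
      "{v\<in>V. part v = U3} = S" "{v\<in>V. part v = V3} = T"
      using D by (auto simp: V pS pT pP pQ split: if_splits)
    thus "card {v\<in>V. part v = p} = (if p = U3 \<or> p = V3 then k / 2 else b)"
      using sub[OF finP] sub[OF finQ] compl_card[OF finP] compl_card[OF finQ] E(6)[OF x0H] cST cP cQ
      by (cases p) simp_all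
  qed
qed

text \<open>All edges cross, so having \<open>n^2 / 4\<close> of them forces equal sides and no
  missing pair.\<close>

lemma balanced_structure:
  assumes H: "H = {}"
  shows "card A = card (V - A)" "u \<in> V \<Longrightarrow> v \<in> V \<Longrightarrow> w u v = 1 \<longleftrightarrow> (u \<in> A) \<noteq> (v \<in> A)"
proof -
  have low: "low A = {}" "low (V - A) = {}" using H by (auto simp: H_def)
  have PQ: "P = A" "Q = V - A" by (simp_all add: P_def Q_def low)
  have "(\<Sum>x\<in>V. dg V x) = 2 * (real (card A) * card (V - A) - mis)"
    using sum_dg_V H PQ by simp
  moreover define d where "d = (real (card A) - card (V - A))\<^sup>2"
  have "(real (card V))\<^sup>2 / 2 = 2 * (real (card A) * card (V - A)) + d / 2"
    unfolding d_def card_V card_A_compl[symmetric] by (simp add: field_simps power2_eq_square)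
  moreover have "0 \<le> d" by (simp add: d_def)
  ultimately have z: "mis = 0" "d = 0" using edges mis_nonneg by argo+
  thus "card A = card (V - A)" by (simp add: d_def)
  have AB: "w u v = 1" if "u \<in> A" "v \<in> V - A" for u v
    using mis_zeroD[OF z(1)] that PQ by simp
  assume "u \<in> V" "v \<in> V"
  thus "w u v = 1 \<longleftrightarrow> (u \<in> A) \<noteq> (v \<in> A)"
    using AB[of u v] AB[of v u] indep_P[of u v] indep_Q[of u v] w_sym[of u v] PQ by auto
qed

end

subsection \<open>Triangles, books and blow-ups of the prism\<close>

lemma edge_verts: "simple_graph G \<Longrightarrow> {u, v} \<in> edges G \<Longrightarrow> u \<in> verts G \<and> v \<in> verts G \<and> u \<noteq> v"
proof -
  assume "simple_graph G" "{u, v} \<in> edges G"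
  hence "{u, v} \<in> nsets (verts G) 2" unfolding simple_graph_def by blast
  thus ?thesis by (auto simp: nsets_def card_insert_if split: if_splits)
qed

lemma finite_edges: "simple_graph G \<Longrightarrow> finite (edges G)"
  by (auto simp: simple_graph_def intro: finite_subset finite_imp_finite_nsets)

lemma finite_triangles: "simple_graph G \<Longrightarrow> finite (triangles G)"
  by (auto simp: simple_graph_def triangles_def intro!: finite_Collect_conjI finite_imp_finite_nsets)

lemma nsets_2_triple: "x \<noteq> y \<Longrightarrow> y \<noteq> z \<Longrightarrow> x \<noteq> z \<Longrightarrow> nsets {x, y, z} 2 = {{x, y}, {y, z}, {x, z}}"
  by (auto simp: nsets_def card_2_iff)

lemma triangleI:
  assumes G: "simple_graph G" and "{x, y} \<in> edges G" "{y, z} \<in> edges G" "{x, z} \<in> edges G"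
  shows "{x, y, z} \<in> triangles G"
proof -
  have "x \<noteq> y" "y \<noteq> z" "x \<noteq> z" "{x, y, z} \<subseteq> verts G" using assms(2-4) edge_verts[OF G] by blast+
  thus ?thesis using assms(2-4) by (simp add: triangles_def nsets_2_triple) (simp add: nsets_def)
qed

lemma triangleE:
  assumes "T \<in> triangles G"
  obtains x y z where "T = {x, y, z}" "x \<noteq> y" "y \<noteq> z" "x \<noteq> z" "x \<in> verts G" "y \<in> verts G" "z \<in> verts G"
    "{x, y} \<in> edges G" "{y, z} \<in> edges G" "{x, z} \<in> edges G"
proof -
  have "card T = 3" "T \<subseteq> verts G" "nsets T 2 \<subseteq> edges G" using assms by (auto simp: triangles_def nsets_def)
  then obtain x y z where "T = {x, y, z}" "x \<noteq> y" "y \<noteq> z" "x \<noteq> z" by (auto simp: card_3_iff)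
  thus thesis using that \<open>T \<subseteq> verts G\<close> \<open>nsets T 2 \<subseteq> edges G\<close> by (auto simp: nsets_2_triple)
qed

text \<open>The triangles over \<open>uv\<close> form a book with one triangle per common neighbour.
  The maximum is over a finite set because every book is a subset of the finite set of
  triangles.\<close>

lemma codeg_le_book_number:
  assumes G: "simple_graph G" and uv: "{u, v} \<in> edges G"
  shows "card {z. {u, z} \<in> edges G \<and> {v, z} \<in> edges G} \<le> book_number G"
proof -
  let ?Z = "{z. {u, z} \<in> edges G \<and> {v, z} \<in> edges G}"
  let ?B = "(\<lambda>z. {u, v, z}) ` ?Z"
  have "is_book G ?B" unfolding is_book_def
  proof
    show "?B \<subseteq> triangles G" using triangleI[OF G uv] by auto
    show "\<exists>e\<in>edges G. \<forall>T\<in>?B. e \<subseteq> T" by (rule bexI[OF _ uv]) auto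
  qed
  moreover have "inj_on (\<lambda>z. {u, v, z}) ?Z"
  proof (rule inj_onI)
    fix y z assume yz: "y \<in> ?Z" "z \<in> ?Z" "{u, v, y} = {u, v, z}"
    have "y \<noteq> u" "y \<noteq> v" using yz(1) edge_verts[OF G, of u y] edge_verts[OF G, of v y] by auto
    thus "y = z" using yz(3) by blast
  qed
  hence "card ?B = card ?Z" by (rule card_image)
  moreover have "finite {B. is_book G B}"
    by (rule finite_subset[of _ "Pow (triangles G)"]) (auto simp: is_book_def finite_triangles[OF G])
  moreover have "card ?B \<in> card ` {B. is_book G B}" using \<open>is_book G ?B\<close> by (intro imageI CollectI)
  ultimately show ?thesis unfolding book_number_def by (intro Max_ge) simp_all
qed

lemma graph_iso_card_triangles_le:
  assumes iso: "graph_iso G H" and H: "simple_graph H"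
  shows "card (triangles G) \<le> card (triangles H)"
proof -
  obtain f where f: "bij_betw f (verts G) (verts H)"
    "\<And>u v. u \<in> verts G \<Longrightarrow> v \<in> verts G \<Longrightarrow> {u, v} \<in> edges G \<longleftrightarrow> {f u, f v} \<in> edges H"
    using iso by (auto simp: graph_iso_def)
  show ?thesis
  proof (rule card_inj_on_le)
    show "inj_on ((`) f) (triangles G)"
      using inj_on_image_Pow[OF bij_betw_imp_inj_on[OF f(1)]]
      by (rule inj_on_subset) (auto simp: triangles_def nsets_def)
    show "(`) f ` triangles G \<subseteq> triangles H"
    proof (intro image_subsetI)
      fix T assume "T \<in> triangles G"
      then show "f ` T \<in> triangles H" by (rule triangleE) (auto intro!: triangleI[OF H] simp: f(2)[symmetric])
    qed
  qed (rule finite_triangles[OF H])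
qed

section \<open>The blow-up of the prism and its triangles\<close>

lemma S_edge_iff:
  "{(p, i), (q, j)} \<in> edges (S_graph b n) \<longleftrightarrow>
     i < S_part_size b n p \<and> j < S_part_size b n q \<and> {p, q} \<in> prism_edges"
  unfolding S_graph_def by (auto simp: doubleton_eq_iff insert_commute)

instance prism_vertex :: finite
proof
  have "UNIV = {U1, U2, U3, V1, V2, V3}" by (auto intro: prism_vertex.exhaust)
  moreover have "finite {U1, U2, U3, V1, V2, V3}" by simp
  ultimately show "finite (UNIV :: prism_vertex set)" by metis
qed

lemma prism_edges_irrefl: "{p, p} \<notin> prism_edges"
  by (auto simp: prism_edges_def doubleton_eq_iff)

lemma prism_triangle:
  assumes "{p, q} \<in> prism_edges" "{q, r} \<in> prism_edges" "{p, r} \<in> prism_edges"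
  shows "{p, q, r} = {U1, U2, U3} \<or> {p, q, r} = {V1, V2, V3}"
  using assms by (cases p; cases q; cases r) (auto simp: prism_edges_def doubleton_eq_iff)

lemma simple_S: "simple_graph (S_graph b n)"
  unfolding simple_graph_def S_graph_def
  using prism_edges_irrefl by (auto simp: nsets_def card_insert_if)

text \<open>Triangles project onto one of the two triangles of the prism. An upper bound suffices,
  since \<open>few_triangles_structure\<close> turns it into equality.\<close>

lemma card_triangles_S_le: "card (triangles (S_graph b n)) \<le> b\<^sup>2 * (S_part_size b n U3 + S_part_size b n V3)"
proof -
  let ?s = "S_part_size b n"
  let ?X = "\<lambda>p q r. (\<lambda>(i, j, l). {(p, i), (q, j), (r, l)}) ` ({..<?s p} \<times> {..<?s q} \<times> {..<?s r})"
  \<comment> \<open>A set of three vertices projecting onto three distinct parts has exactly one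
    vertex in each.\<close>
  have mem: "T \<in> ?X p q r" if T: "card T = 3" "fst ` T = {p, q, r}" "p \<noteq> q" "q \<noteq> r" "p \<noteq> r"
    "T \<subseteq> verts (S_graph b n)" for T p q r
  proof -
    have "p \<in> fst ` T" "q \<in> fst ` T" "r \<in> fst ` T" using T by auto
    then obtain i j l where m: "(p, i) \<in> T" "(q, j) \<in> T" "(r, l) \<in> T" by force
    have "{(p, i), (q, j), (r, l)} = T"
      using m T by (intro card_subset_eq) (auto simp: card_ge_0_finite)
    moreover have "i < ?s p" "j < ?s q" "l < ?s r" using m T(6) by (auto simp: S_graph_def)
    ultimately show ?thesis by (intro image_eqI[of _ _ "(i, j, l)"]) auto
  qed
  have "triangles (S_graph b n) \<subseteq> ?X U1 U2 U3 \<union> ?X V1 V2 V3"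
  proof
    fix T assume T: "T \<in> triangles (S_graph b n)"
    hence c: "card T = 3" "T \<subseteq> verts (S_graph b n)" by (auto simp: triangles_def nsets_def)
    from T obtain x y z where xyz: "T = {x, y, z}" "{x, y} \<in> edges (S_graph b n)"
      "{y, z} \<in> edges (S_graph b n)" "{x, z} \<in> edges (S_graph b n)" by (rule triangleE)
    have "fst ` T = {U1, U2, U3} \<or> fst ` T = {V1, V2, V3}"
      using prism_triangle[of "fst x" "fst y" "fst z"] xyz
      by (cases x; cases y; cases z) (simp add: S_edge_iff)
    thus "T \<in> ?X U1 U2 U3 \<union> ?X V1 V2 V3" using mem[OF c(1) _ _ _ _ c(2)] by blast
  qed
  hence "card (triangles (S_graph b n)) \<le> card (?X U1 U2 U3 \<union> ?X V1 V2 V3)"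
    by (intro card_mono) auto
  also have "\<dots> \<le> card (?X U1 U2 U3) + card (?X V1 V2 V3)" by (rule card_Un_le)
  also have "\<dots> \<le> card ({..<?s U1} \<times> {..<?s U2} \<times> {..<?s U3}) + card ({..<?s V1} \<times> {..<?s V2} \<times> {..<?s V3})"
    by (intro add_mono card_image_le) auto
  also have "\<dots> = b\<^sup>2 * (?s U3 + ?s V3)"
    by (simp add: card_cartesian_product power2_eq_square algebra_simps del: S_part_size.simps(1,2))
  finally show ?thesis .
qed

lemma nat_floor_add_ceiling_half: "nat \<lfloor>real m / 2\<rfloor> + nat \<lceil>real m / 2\<rceil> = m"
proof (cases "even m")
  case False
  then obtain c where "m = 2 * c + 1" by (rule oddE)
  hence "real m / 2 = real c + 1 / 2" by simp
  hence "\<lfloor>real m / 2\<rfloor> = int c" "\<lceil>real m / 2\<rceil> = int c + 1" by linarith+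
  thus ?thesis using \<open>m = 2 * c + 1\<close> by simp
next
  case True
  then obtain c where "m = 2 * c" by (rule evenE)
  thus ?thesis by simp
qed

lemma graph_iso_S_graphI:
  assumes G: "simple_graph G"
    and adj: "\<And>u v. u \<in> verts G \<Longrightarrow> v \<in> verts G \<Longrightarrow> {u, v} \<in> edges G \<longleftrightarrow> {part u, part v} \<in> prism_edges"
    and size: "\<And>p. card {v \<in> verts G. part v = p} = S_part_size b n p"
  shows "graph_iso G (S_graph b n)"
proof -
  have fin: "finite (verts G)" using G by (simp add: simple_graph_def)
  have "\<exists>g. bij_betw g {v \<in> verts G. part v = p} {..<S_part_size b n p}" for p
    using fin size by (intro finite_same_card_bij) auto
  then obtain g where g: "\<And>p. bij_betw (g p) {v \<in> verts G. part v = p} {..<S_part_size b n p}" by metis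
  define f where "f v = (part v, g (part v) v)" for v
  have lt: "g (part v) v < S_part_size b n (part v)" if "v \<in> verts G" for v
    using bij_betwE[OF g[of "part v"]] that by auto
  have "bij_betw f (verts G) (verts (S_graph b n))"
    unfolding bij_betw_def
  proof
    show "inj_on f (verts G)"
      using bij_betw_imp_inj_on[OF g] by (auto simp: inj_on_def f_def)
    have "\<exists>v\<in>verts G. f v = (p, i)" if "i < S_part_size b n p" for p i
    proof -
      have "i \<in> g p ` {v \<in> verts G. part v = p}" using that bij_betw_imp_surj_on[OF g] by auto
      thus ?thesis by (auto simp: f_def)
    qed
    thus "f ` verts G = verts (S_graph b n)" using lt by (force simp: S_graph_def f_def)
  qed
  moreover have "{u, v} \<in> edges G \<longleftrightarrow> {f u, f v} \<in> edges (S_graph b n)" if "u \<in> verts G" "v \<in> verts G" for u v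
    using that lt by (simp add: f_def S_edge_iff adj)
  ultimately show ?thesis by (auto simp: graph_iso_def)
qed

section \<open>Recognizing the balanced complete bipartite graph\<close>

lemma complete_bipartite_edge_iff:
  "{Inl i, Inr j} \<in> edges (complete_bipartite p q) \<longleftrightarrow> i < p \<and> j < q"
  "{Inr j, Inl i} \<in> edges (complete_bipartite p q) \<longleftrightarrow> i < p \<and> j < q"
  "{Inl i, Inl i'} \<notin> edges (complete_bipartite p q)"
  "{Inr j, Inr j'} \<notin> edges (complete_bipartite p q)"
  by (auto simp: complete_bipartite_def doubleton_eq_iff)

lemma graph_iso_balanced_complete_bipartiteI:
  assumes G: "simple_graph G" and A: "A \<subseteq> verts G" "card A = card (verts G - A)"
    and adj: "\<And>u v. u \<in> verts G \<Longrightarrow> v \<in> verts G \<Longrightarrow> {u, v} \<in> edges G \<longleftrightarrow> (u \<in> A) \<noteq> (v \<in> A)"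
  shows "graph_iso G (balanced_complete_bipartite (card (verts G)))"
proof -
  let ?c = "card A" and ?B = "verts G - A"
  have fin: "finite (verts G)" "finite A" using G A finite_subset by (auto simp: simple_graph_def)
  have "card (verts G) = 2 * ?c" using A card_Diff_subset[OF fin(2) A(1)] card_mono[OF fin(1) A(1)] by simp
  \<comment> \<open>The number of vertices is even, so floor and ceiling of its half
    coincide.\<close>
  hence K: "balanced_complete_bipartite (card (verts G)) = complete_bipartite ?c ?c"
    by (simp add: balanced_complete_bipartite_def)
  obtain g where g: "bij_betw g A {..<?c}"
    using finite_same_card_bij[OF fin(2), of "{..<?c}"] by auto
  obtain h where h: "bij_betw h ?B {..<?c}"
    using finite_same_card_bij[of ?B "{..<?c}"] fin(1) A(2)[symmetric] by auto
  define f where "f v = (if v \<in> A then Inl (g v) else Inr (h v))" for v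
  have lt: "v \<in> A \<Longrightarrow> g v < ?c" "v \<in> ?B \<Longrightarrow> h v < ?c" for v
    using bij_betwE[OF g] bij_betwE[OF h] by blast+
  have "bij_betw f (verts G) (verts (complete_bipartite ?c ?c))"
    unfolding bij_betw_def
  proof
    show "inj_on f (verts G)"
      using bij_betw_imp_inj_on[OF g] bij_betw_imp_inj_on[OF h] by (auto simp: inj_on_def f_def)
    have "f ` verts G = f ` A \<union> f ` ?B" using A(1) by blast
    moreover have "f ` A = Inl ` {..<?c}"
      unfolding bij_betw_imp_surj_on[OF g, symmetric] by (auto simp: f_def image_image)
    moreover have "f ` ?B = Inr ` {..<?c}"
      unfolding bij_betw_imp_surj_on[OF h, symmetric] by (auto simp: f_def image_image)
    ultimately show "f ` verts G = verts (complete_bipartite ?c ?c)"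
      by (simp add: complete_bipartite_def Plus_def)
  qed
  moreover have "{u, v} \<in> edges G \<longleftrightarrow> {f u, f v} \<in> edges (complete_bipartite ?c ?c)"
    if "u \<in> verts G" "v \<in> verts G" for u v
    unfolding adj[OF that] f_def
    using that lt[of u] lt[of v] by (cases "u \<in> A"; cases "v \<in> A") (simp_all add: complete_bipartite_edge_iff)
  ultimately show ?thesis unfolding K by (auto simp: graph_iso_def)
qed

section \<open>Counting ordered edges and triangles with 0/1 weights\<close>

definition adjw :: "'a ugraph \<Rightarrow> 'a \<Rightarrow> 'a \<Rightarrow> real" where
  "adjw G u v = of_bool ({u, v} \<in> edges G)"

lemma adjw_eq_1_iff: "adjw G u v = 1 \<longleftrightarrow> {u, v} \<in> edges G"
  by (simp add: adjw_def)

lemma weighted_graph_adjw: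
  assumes G: "simple_graph G"
  shows "weighted_graph (verts G) (adjw G)"
proof -
  have "{u} \<notin> edges G" for u using edge_verts[OF G, of u u] by auto
  moreover have "finite (verts G)" using G by (simp add: simple_graph_def)
  ultimately show ?thesis by unfold_locales (auto simp: adjw_def insert_commute)
qed

lemma sum_adjw:
  assumes G: "simple_graph G"
  shows "(\<Sum>u\<in>verts G. \<Sum>v\<in>verts G. adjw G u v) = 2 * real (card (edges G))"
proof -
  let ?V = "verts G" and ?F = "\<lambda>e. {(u, v). {u, v} = e}"
  have fin: "finite ?V" using G by (simp add: simple_graph_def)
  have "card (?F e) = 2 \<and> finite (?F e)" if "e \<in> edges G" for e
  proof -
    have "card e = 2" using that G by (auto simp: simple_graph_def nsets_def)
    then obtain x y where xy: "e = {x, y}" "x \<noteq> y" by (auto simp: card_2_iff)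
    have "?F e = {(x, y), (y, x)}" unfolding xy by (auto simp: doubleton_eq_iff)
    thus ?thesis using xy(2) by simp
  qed
  hence "card (\<Union>e\<in>edges G. ?F e) = (\<Sum>e\<in>edges G. 2)"
    using finite_edges[OF G] by (subst card_UN_disjoint) auto
  moreover have "(\<Union>e\<in>edges G. ?F e) = ?V \<times> ?V \<inter> {(u, v). {u, v} \<in> edges G}"
    using edge_verts[OF G] by auto
  moreover have "(\<Sum>u\<in>?V. \<Sum>v\<in>?V. adjw G u v) = (\<Sum>p\<in>?V \<times> ?V. of_bool (case p of (u, v) \<Rightarrow> {u, v} \<in> edges G))"
    unfolding sum.cartesian_product adjw_def by (intro sum.cong refl) auto
  moreover have "\<dots> = real (card (?V \<times> ?V \<inter> {(u, v). {u, v} \<in> edges G}))"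
    using fin by (subst sum_of_bool_eq) auto
  ultimately show ?thesis by simp
qed

lemma sum_triples_adjw:
  assumes "finite X" "finite Y" "finite Z"
  shows "(\<Sum>x\<in>X. \<Sum>y\<in>Y. \<Sum>z\<in>Z. adjw G x y * adjw G x z * adjw G y z) =
    real (card {(x, y, z). x \<in> X \<and> y \<in> Y \<and> z \<in> Z \<and> {x, y} \<in> edges G \<and> {x, z} \<in> edges G \<and> {y, z} \<in> edges G})"
proof -
  let ?E = "{(x, y, z). {x, y} \<in> edges G \<and> {x, z} \<in> edges G \<and> {y, z} \<in> edges G}"
  have "(\<Sum>x\<in>X. \<Sum>y\<in>Y. \<Sum>z\<in>Z. adjw G x y * adjw G x z * adjw G y z)
    = (\<Sum>p\<in>X \<times> Y \<times> Z. of_bool (p \<in> ?E))"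
    unfolding sum.cartesian_product adjw_def by (intro sum.cong refl) auto
  also have "\<dots> = real (card (X \<times> Y \<times> Z \<inter> {p. p \<in> ?E}))"
    using assms by (subst sum_of_bool_eq) auto
  also have "X \<times> Y \<times> Z \<inter> {p. p \<in> ?E} = {(x, y, z). x \<in> X \<and> y \<in> Y \<and> z \<in> Z \<and>
      {x, y} \<in> edges G \<and> {x, z} \<in> edges G \<and> {y, z} \<in> edges G}" by auto
  finally show ?thesis .
qed

text \<open>Each triangle has at most six orderings.\<close>

lemma sum_triples_adjw_le:
  assumes G: "simple_graph G"
  shows "(\<Sum>x\<in>verts G. \<Sum>y\<in>verts G. \<Sum>z\<in>verts G. adjw G x y * adjw G x z * adjw G y z)
    \<le> 6 * real (card (triangles G))"
proof -
  let ?F = "\<lambda>T. {(x, y, z). {x, y, z} = T}" and ?V = "verts G"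
  have fin: "finite ?V" using G by (simp add: simple_graph_def)
  have F: "finite (?F T) \<and> card (?F T) \<le> 6" if T: "T \<in> triangles G" for T
  proof -
    obtain a b c where abc: "T = {a, b, c}" "a \<noteq> b" "b \<noteq> c" "a \<noteq> c" using T by (rule triangleE)
    let ?L = "[(a, b, c), (a, c, b), (b, a, c), (b, c, a), (c, a, b), (c, b, a)]"
    have "?F T \<subseteq> set ?L"
    proof
      fix p assume "p \<in> ?F T"
      then obtain x y z where p: "p = (x, y, z)" "{x, y, z} = T" by (cases p) auto
      hence "x \<in> {a, b, c}" "y \<in> {a, b, c}" "z \<in> {a, b, c}" "a \<in> {x, y, z}" "b \<in> {x, y, z}" "c \<in> {x, y, z}"
        using abc(1) by auto
      thus "p \<in> set ?L" unfolding p(1) using abc(2-4) by auto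
    qed
    hence "finite (?F T)" "card (?F T) \<le> card (set ?L)" by (auto intro: finite_subset card_mono)
    moreover have "card (set ?L) \<le> length ?L" by (rule card_length)
    ultimately show ?thesis by simp
  qed
  have "card {(x, y, z). x \<in> ?V \<and> y \<in> ?V \<and> z \<in> ?V \<and> {x, y} \<in> edges G \<and> {x, z} \<in> edges G \<and> {y, z} \<in> edges G}
    \<le> card (\<Union>T\<in>triangles G. ?F T)"
  proof (rule card_mono)
    show "finite (\<Union>T\<in>triangles G. ?F T)" using finite_triangles[OF G] F by blast
    show "{(x, y, z). x \<in> ?V \<and> y \<in> ?V \<and> z \<in> ?V \<and> {x, y} \<in> edges G \<and> {x, z} \<in> edges G \<and> {y, z} \<in> edges G}
      \<subseteq> (\<Union>T\<in>triangles G. ?F T)"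
      by (clarsimp simp: triangleI[OF G])
  qed
  also have "\<dots> \<le> (\<Sum>T\<in>triangles G. card (?F T))" using finite_triangles[OF G] by (rule card_UN_le)
  also have "\<dots> \<le> (\<Sum>T\<in>triangles G. 6)" using F by (intro sum_mono) auto
  finally show ?thesis unfolding sum_triples_adjw[OF fin fin fin] by simp
qed

text \<open>With disjoint classes a triangle determines its ordering, so there is no factor six.
  Applied to \<open>H\<close>, \<open>P\<close>, \<open>Q\<close>, this bounds the sum of
  \<open>tri\<close>.\<close>

lemma sum_triples_adjw_disjoint_le:
  assumes G: "simple_graph G" and fin: "finite X" "finite Y" "finite Z"
    and disj: "X \<inter> Y = {}" "X \<inter> Z = {}" "Y \<inter> Z = {}"
  shows "(\<Sum>x\<in>X. \<Sum>y\<in>Y. \<Sum>z\<in>Z. adjw G x y * adjw G x z * adjw G y z) \<le> real (card (triangles G))"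
  unfolding sum_triples_adjw[OF fin] of_nat_le_iff
proof (rule card_inj_on_le[where f = "\<lambda>(x, y, z). {x, y, z}"])
  let ?D = "{(x, y, z). x \<in> X \<and> y \<in> Y \<and> z \<in> Z \<and> {x, y} \<in> edges G \<and> {x, z} \<in> edges G \<and> {y, z} \<in> edges G}"
  show "inj_on (\<lambda>(x, y, z). {x, y, z}) ?D"
  proof (rule inj_onI)
    fix p q assume "p \<in> ?D" "q \<in> ?D" "(case p of (x, y, z) \<Rightarrow> {x, y, z}) = (case q of (x, y, z) \<Rightarrow> {x, y, z})"
    then obtain x y z x' y' z' where pq: "p = (x, y, z)" "q = (x', y', z')"
      and m: "x \<in> X" "y \<in> Y" "z \<in> Z" "x' \<in> X" "y' \<in> Y" "z' \<in> Z"
      and e: "{x, y, z} = {x', y', z'}" by (cases p; cases q) auto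
    have "x \<in> {x', y', z'}" "y \<in> {x', y', z'}" "z \<in> {x', y', z'}" using e by auto
    thus "p = q" unfolding pq using m disj by auto
  qed
  show "(\<lambda>(x, y, z). {x, y, z}) ` ?D \<subseteq> triangles G" by (auto intro: triangleI[OF G])
qed (rule finite_triangles[OF G])

text \<open>The hypothesis \<open>few\<close> covers both a hypothetical counterexample and the case
  of equality.\<close>

lemma few_triangles_structure:
  fixes G :: "'a ugraph" and n b :: nat
  assumes nb: "0.2495 * real n \<le> real b" "real b < real n / 4"
    and G: "simple_graph G" and n: "card (verts G) = n"
    and edges: "real (card (edges G)) \<ge> (real n)\<^sup>2 / 4"
    and book: "book_number G \<le> b"
    and not_bip: "\<not> graph_iso G (balanced_complete_bipartite n)"
    and few: "real (card (triangles G)) \<le> (real b)\<^sup>2 * (real n - 4 * real b)"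
  shows "real (card (triangles G)) = (real b)\<^sup>2 * (real n - 4 * real b) \<and> graph_iso G (S_graph b n)"
proof -
  define k where "k = real n - 4 * real b"
  \<comment> \<open>\<open>0.2495 * n \<le> b\<close> gives
    \<open>k \<le> (1 / 0.2495 - 4) * b\<close>, which is below \<open>b / 124\<close>.\<close>
  have k: "0 < k" "124 * k \<le> real b" using nb by (simp_all add: k_def)
  interpret weighted_graph "verts G" "adjw G" using G by (rule weighted_graph_adjw)
  obtain A where A: "A \<subseteq> verts G" "\<And>X. X \<subseteq> verts G \<Longrightarrow> cut X \<le> cut A" by (rule obtain_max_cut) blast
  have sum_dg: "(\<Sum>u\<in>verts G. dg (verts G) u) = 2 * real (card (edges G))"
    using sum_adjw[OF G] by (simp add: dg_def)
  have edges': "(real (card (verts G)))\<^sup>2 / 2 \<le> (\<Sum>u\<in>verts G. dg (verts G) u)"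
    using edges by (simp add: sum_dg n)
  \<comment> \<open>The averaged cut loses at most the ordered triangles,
    \<open>6 * b^2 * k\<close>, which is \<open>4 * b\<close> times \<open>3 / 2 * b * k\<close>;
    finally \<open>4 * b \<le> n\<close>.\<close>
  have "real n * ((\<Sum>u\<in>verts G. dg (verts G) u) / 2 - cut A) \<le> 6 * real (card (triangles G))"
    using max_cut_ge[OF edges' A(2)] sum_triples_adjw_le[OF G] by (simp add: n right_diff_distrib)
  also have "\<dots> \<le> 4 * real b * (3 / 2 * real b * k)" using few by (simp add: k_def power2_eq_square)
  also have "\<dots> \<le> real n * (3 / 2 * real b * k)" using k by (intro mult_right_mono) (auto simp: k_def)
  finally have inner: "(\<Sum>u\<in>verts G. dg (verts G) u) / 2 - cut A \<le> 3 / 2 * real b * k"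
    using k by (simp add: k_def)
  interpret book_cut "verts G" "adjw G" A "real b" k
  proof unfold_locales
    show "A \<subseteq> verts G" by fact
    show "x \<in> A \<Longrightarrow> dg A x \<le> dg (verts G - A) x" for x
      using A(1) by (intro max_cut_dg_le A(2)) auto
    show "dg (verts G - A) x \<le> dg A x" if "x \<in> verts G - A" for x
      using max_cut_dg_le[of "verts G - A" x] A(2)[of "verts G - A - {x}"] A(1) that
      by (auto simp: double_diff cut_compl)
    show "cod (verts G) u v \<le> real b" if "adjw G u v = 1" for u v
    proof -
      have "cod (verts G) u v = (\<Sum>z\<in>verts G. of_bool ({u, z} \<in> edges G \<and> {v, z} \<in> edges G))"
        by (simp add: cod_def adjw_def of_bool_conj)
      also have "\<dots> = real (card (verts G \<inter> {z. {u, z} \<in> edges G \<and> {v, z} \<in> edges G}))"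
        using fin by (subst sum_of_bool_eq) auto
      also have "verts G \<inter> {z. {u, z} \<in> edges G \<and> {v, z} \<in> edges G} = {z. {u, z} \<in> edges G \<and> {v, z} \<in> edges G}"
        using edge_verts[OF G] by blast
      finally show ?thesis using codeg_le_book_number[OF G, of u v] that book by (simp add: adjw_eq_1_iff)
    qed
  qed (use k edges' inner fin in \<open>simp_all add: n k_def\<close>)
  have H: "H \<noteq> {}"
  proof
    assume "H = {}"
    hence "graph_iso G (balanced_complete_bipartite (card (verts G)))"
      using balanced_structure A(1) by (intro graph_iso_balanced_complete_bipartiteI[OF G]) (auto simp: adjw_eq_1_iff)
    thus False using not_bip n by simp
  qed
  have tri_le: "(\<Sum>x\<in>H. tri x) \<le> real (card (triangles G))"
    unfolding tri_def using disj finP finQ finH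
    by (intro sum_triples_adjw_disjoint_le[OF G]) auto
  hence few': "(\<Sum>x\<in>H. tri x) \<le> (real b)\<^sup>2 * k" using few by (simp add: k_def)
  have "real (card (triangles G)) = (real b)\<^sup>2 * k"
    using extremal_counts(5)[OF H few'] tri_le few by (simp add: k_def)
  moreover obtain part where part:
    "\<And>u v. u \<in> verts G \<Longrightarrow> v \<in> verts G \<Longrightarrow> adjw G u v = 1 \<longleftrightarrow> {part u, part v} \<in> prism_edges"
    "\<And>p. card {v \<in> verts G. part v = p} = (if p = U3 \<or> p = V3 then k / 2 else real b)"
    using extremal_structure[OF H few'] by blast
  have "graph_iso G (S_graph b n)"
  proof (rule graph_iso_S_graphI[OF G])
    show "{u, v} \<in> edges G \<longleftrightarrow> {part u, part v} \<in> prism_edges" if "u \<in> verts G" "v \<in> verts G" for u v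
      using part(1)[OF that] by (simp add: adjw_eq_1_iff)
    \<comment> \<open>\<open>k / 2\<close> is the size of a part, hence an integer, so rounding does
      not affect the sizes of \<open>U3\<close> and \<open>V3\<close>.\<close>
    define c where "c = card {v \<in> verts G. part v = U3}"
    have k2: "k / 2 = real c" using part(2)[of U3] by (simp add: c_def)
    hence "S_part_size b n U3 = c" "S_part_size b n V3 = c"
      unfolding k_def S_part_size.simps by (simp_all only: floor_of_nat ceiling_of_nat nat_int)
    thus "card {v \<in> verts G. part v = p} = S_part_size b n p" for p
      using part(2)[of p] unfolding k2 by (cases p) simp_all
  qed
  ultimately show ?thesis by (simp add: k_def)
qed

theorem theorem1p2:
  fixes n b :: nat and G :: "'a ugraph"
  assumes "0.2495 * real n \<le> real b" and "real b < real n / 4"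
    and "simple_graph G" and "card (verts G) = n"
    and "real (card (edges G)) \<ge> (real n)\<^sup>2 / 4"
    and "book_number G \<le> b"
    and "\<not> graph_iso G (balanced_complete_bipartite n)"
  shows "real (card (triangles G)) \<ge> (real b)\<^sup>2 * (real n - 4 * real b) \<and>
         (real (card (triangles G)) = (real b)\<^sup>2 * (real n - 4 * real b) \<longleftrightarrow>
            graph_iso G (S_graph b n))"
proof -
  let ?m = "(real b)\<^sup>2 * (real n - 4 * real b)"
  have "real (card (triangles G)) \<le> ?m" if "graph_iso G (S_graph b n)"
  proof -
    have n: "real (n - 4 * b) = real n - 4 * real b" using assms(2) by simp
    have "S_part_size b n U3 + S_part_size b n V3 = n - 4 * b"
      using nat_floor_add_ceiling_half[of "n - 4 * b"] by (simp add: n)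
    hence "card (triangles G) \<le> b\<^sup>2 * (n - 4 * b)"
      using graph_iso_card_triangles_le[OF that simple_S] card_triangles_S_le[of b n] by simp
    hence "real (card (triangles G)) \<le> real (b\<^sup>2 * (n - 4 * b))" by (simp only: of_nat_le_iff)
    thus ?thesis by (simp add: n)
  qed
  \<comment> \<open>At most \<open>?m\<close> triangles force equality and the isomorphism;
    conversely the isomorphism gives at most \<open>?m\<close> triangles.\<close>
  thus ?thesis using few_triangles_structure[OF assms] by linarith
qed

end
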